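(* Let $n,r\ge1$. The monomials $\{\mathfrak{s}(w):w\in\mathfrak{S}_{n,r}\}$ descend to a spanning set of $\mathbb{C}[\mathbf{x}_{n\times n}]/I_{\mathfrak{S}_{n,r}}$.
   Context: $\mathbb{C}[\mathbf{x}_{n\times n}]$ is the polynomial ring in variables $x_{i,j}$, $1\le i,j\le n$. $I_{\mathfrak{S}_{n,r}}$ is the ideal generated by: $x_{i,j}^{r+1}$ for all $i,j$; $x_{i,j}x_{i,j'}$ for all $i$ and $j<j'$; $x_{i,j}x_{i',j}$ for all $j$ and $i<i'$; $\sum_{j=1}^n x_{i,j}^r$ for each $i$; $\sum_{i=1}^n x_{i,j}^r$ for each $j$. For $S\subseteq[n]\times[n]$, $m(S)=\prod_{(i,j)\in S}x_{i,j}$. A rook placement is a subset of $[n]\times[n]$ with no two points sharing a first or a second coordinate. Shadow set $\mathcal{S}(P)$ of a rook placement $P$: let $P_1$ be the points $(i,j)\in P$ with no other $(i',j')\in P$ having $i'<i$ and $j'<j$; list them as $(i_1,j_1),\dots,(i_m,j_m)$ with $i_1<\dots<i_m$; the corners are $(i_{t+1},j_t)$, $1\le t\le m-1$; remove $P_1$ and repeat; $\mathcal{S}(P)$ is the set of all corners from all rounds. The colored permutation group $\mathfrak{S}_{n,r}$ consists of pairs $w=(\sigma,\kappa)$, $\sigma\in\mathfrak{S}_n$, $\kappa:[n]\to\{0,1,\dots,r-1\}$. For $0\le l\le r-1$, $C_l(w)=\{(i,\sigma(i)):\kappa(\sigma(i))=l\}$, and $\mathfrak{s}(w)=m(C_1(w))\,m(C_2(w))^2\cdots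 m(C_{r-1}(w))^{r-1}\,m(\mathcal{S}(C_0(w)))^r$. *)

theory Defs
  imports
    "HOL-Library.Poly_Mapping"
    "HOL-Combinatorics.Permutations"
    "HOL-Algebra.QuotRing"
    "Jordan_Normal_Form.VS_Connect"
begin

section \<open>The polynomial ring in the entries of an n by n matrix\<close>

text \<open>
  A monomial is a finitely supported exponent vector, a polynomial a finitely supported family of
  coefficients indexed by monomials; the product is the convolution product of
  \<^theory>\<open>HOL-Library.Poly_Mapping\<close>. The index set is written as \<open>{1..n}\<close>, so the type contains
  further variables, which the carrier of \<open>poly_ring n\<close> excludes.
\<close>

type_synonym cpoly = "((nat \<times> nat) \<Rightarrow>\<^sub>0 nat) \<Rightarrow>\<^sub>0 complex"

definition var :: "nat \<times> nat \<Rightarrow> cpoly" where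
  "var p = Poly_Mapping.single (Poly_Mapping.single p 1) 1"

definition const_poly :: "complex \<Rightarrow> cpoly" where
  "const_poly c = Poly_Mapping.single 0 c"

definition poly_ring :: "nat \<Rightarrow> cpoly ring" where
  "poly_ring n =
     \<lparr> carrier = {f. \<forall>a \<in> Poly_Mapping.keys f. Poly_Mapping.keys a \<subseteq> {1..n} \<times> {1..n}},
       mult = (*), one = 1, zero = 0, add = (+) \<rparr>"

section \<open>The ideal and the quotient algebra\<close>

definition gens :: "nat \<Rightarrow> nat \<Rightarrow> cpoly set" where
  "gens n r =
     {var (i, j) ^ (r + 1) | i j. i \<in> {1..n} \<and> j \<in> {1..n}} \<union>
     {var (i, j) * var (i, j') | i j j'. i \<in> {1..n} \<and> j \<in> {1..n} \<and> j' \<in> {1..n} \<and> j < j'} \<union>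
     {var (i, j) * var (i', j) | i i' j. i \<in> {1..n} \<and> i' \<in> {1..n} \<and> j \<in> {1..n} \<and> i < i'} \<union>
     {(\<Sum>j = 1..n. var (i, j) ^ r) | i. i \<in> {1..n}} \<union>
     {(\<Sum>i = 1..n. var (i, j) ^ r) | j. j \<in> {1..n}}"

definition colored_ideal :: "nat \<Rightarrow> nat \<Rightarrow> cpoly set" where
  "colored_ideal n r = Idl\<^bsub>poly_ring n\<^esub> (gens n r)"

definition residue_class :: "nat \<Rightarrow> nat \<Rightarrow> cpoly \<Rightarrow> cpoly set" where
  "residue_class n r f = colored_ideal n r +>\<^bsub>poly_ring n\<^esub> f"

text \<open>
  The quotient ring \<open>FactRing\<close>, with the action of \<open>c\<close> given by multiplication with the class of
  the constant polynomial \<open>c\<close>.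
\<close>

definition quotient_algebra :: "nat \<Rightarrow> nat \<Rightarrow> (complex, cpoly set) module" where
  "quotient_algebra n r =
     (let Q = poly_ring n Quot colored_ideal n r in
       \<lparr> carrier = carrier Q, mult = mult Q, one = one Q, zero = zero Q, add = add Q,
         smult = (\<lambda>c X. residue_class n r (const_poly c) \<otimes>\<^bsub>Q\<^esub> X) \<rparr>)"

section \<open>Shadow sets\<close>

definition minimal_points :: "(nat \<times> nat) set \<Rightarrow> (nat \<times> nat) set" where
  "minimal_points P = {(i, j) \<in> P. \<not> (\<exists>(i', j') \<in> P. i' < i \<and> j' < j)}"

text \<open>
  For a finite \<open>Q\<close> with pairwise distinct first coordinates, the list \<open>ps\<close> below exists and is unique.
\<close>

definition corners :: "(nat \<times> nat) set \<Rightarrow> (nat \<times> nat) set" where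
  "corners Q =
     {(fst (ps ! Suc t), snd (ps ! t)) | ps t.
        set ps = Q \<and> sorted_wrt (\<lambda>p q. fst p < fst q) ps \<and> Suc t < length ps}"

text \<open>
  Round \<open>k\<close> starts from what is left after \<open>k\<close> removals. For a finite \<open>P\<close> the rounds are eventually
  empty and then contribute no corners.
\<close>

definition shadow_set :: "(nat \<times> nat) set \<Rightarrow> (nat \<times> nat) set" where
  "shadow_set P = (\<Union>k. corners (minimal_points (((\<lambda>R. R - minimal_points R) ^^ k) P)))"

section \<open>Colored permutations and their monomials\<close>

definition colored_perms :: "nat \<Rightarrow> nat \<Rightarrow> ((nat \<Rightarrow> nat) \<times> (nat \<Rightarrow> nat)) set" where
  "colored_perms n r = {\<sigma>. \<sigma> permutes {1..n}} \<times> ({1..n} \<rightarrow>\<^sub>E {0..<r})"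

definition color_class :: "nat \<Rightarrow> (nat \<Rightarrow> nat) \<times> (nat \<Rightarrow> nat) \<Rightarrow> nat \<Rightarrow> (nat \<times> nat) set" where
  "color_class n w l = (case w of (\<sigma>, \<kappa>) \<Rightarrow> {(i, \<sigma> i) | i. i \<in> {1..n} \<and> \<kappa> (\<sigma> i) = l})"

definition set_monomial :: "(nat \<times> nat) set \<Rightarrow> cpoly" where
  "set_monomial S = (\<Prod>p\<in>S. var p)"

definition shadow_monomial :: "nat \<Rightarrow> nat \<Rightarrow> (nat \<Rightarrow> nat) \<times> (nat \<Rightarrow> nat) \<Rightarrow> cpoly" where
  "shadow_monomial n r w =
     (\<Prod>l = 1..r - 1. set_monomial (color_class n w l) ^ l) *
     set_monomial (shadow_set (color_class n w 0)) ^ r"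

section \<open>Well-definedness\<close>

lemma poly_ring_simps [simp]:
  "mult (poly_ring n) = (*)" "one (poly_ring n) = 1"
  "zero (poly_ring n) = 0" "add (poly_ring n) = (+)"
  by (simp_all add: poly_ring_def)

lemma poly_ring_carrier_iff:
  "f \<in> carrier (poly_ring n) \<longleftrightarrow>
     (\<forall>a \<in> Poly_Mapping.keys f. Poly_Mapping.keys a \<subseteq> {1..n} \<times> {1..n})"
  by (simp add: poly_ring_def)

lemma poly_ring_add: "f \<in> carrier (poly_ring n) \<Longrightarrow> g \<in> carrier (poly_ring n) \<Longrightarrow>
    f + g \<in> carrier (poly_ring n)"
  unfolding poly_ring_carrier_iff using Poly_Mapping.keys_add[of f g] by blast

lemma poly_ring_uminus: "f \<in> carrier (poly_ring n) \<Longrightarrow> - f \<in> carrier (poly_ring n)"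
  unfolding poly_ring_carrier_iff by simp

lemma poly_ring_mult:
  assumes "f \<in> carrier (poly_ring n)" "g \<in> carrier (poly_ring n)"
  shows "f * g \<in> carrier (poly_ring n)"
  unfolding poly_ring_carrier_iff
proof
  fix a assume "a \<in> Poly_Mapping.keys (f * g)"
  then obtain b c where "a = b + c" "b \<in> Poly_Mapping.keys f" "c \<in> Poly_Mapping.keys g"
    using Poly_Mapping.keys_mult[of f g] by blast
  then show "Poly_Mapping.keys a \<subseteq> {1..n} \<times> {1..n}"
    using assms Poly_Mapping.keys_add[of b c] unfolding poly_ring_carrier_iff by blast
qed

lemma const_poly_in_poly_ring: "const_poly c \<in> carrier (poly_ring n)"
  by (simp add: poly_ring_carrier_iff const_poly_def)

lemma poly_ring_0: "0 \<in> carrier (poly_ring n)"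
  by (simp add: poly_ring_carrier_iff)

lemma poly_ring_1: "1 \<in> carrier (poly_ring n)"
  using const_poly_in_poly_ring[of 1 n] by (simp add: const_poly_def)

lemma poly_ring_cring: "cring (poly_ring n)"
proof (rule cringI)
  show "abelian_group (poly_ring n)"
    by (rule abelian_groupI)
       (auto simp: poly_ring_add poly_ring_0 algebra_simps
             intro: bexI[of _ "- x" for x] poly_ring_uminus)
  show "Group.comm_monoid (poly_ring n)"
    by (rule comm_monoidI) (auto simp: poly_ring_mult poly_ring_1 algebra_simps)
qed (simp add: algebra_simps)

lemma var_in_poly_ring: "p \<in> {1..n} \<times> {1..n} \<Longrightarrow> var p \<in> carrier (poly_ring n)"
  by (simp add: poly_ring_carrier_iff var_def)

lemma poly_ring_power: "f \<in> carrier (poly_ring n) \<Longrightarrow> f ^ k \<in> carrier (poly_ring n)"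
  by (induction k) (auto simp: poly_ring_1 poly_ring_mult)

lemma poly_ring_sum: "(\<And>x. x \<in> A \<Longrightarrow> f x \<in> carrier (poly_ring n)) \<Longrightarrow>
    (\<Sum>x\<in>A. f x) \<in> carrier (poly_ring n)"
  by (induction A rule: infinite_finite_induct) (auto simp: poly_ring_0 poly_ring_add)

lemma poly_ring_prod: "(\<And>x. x \<in> A \<Longrightarrow> f x \<in> carrier (poly_ring n)) \<Longrightarrow>
    (\<Prod>x\<in>A. f x) \<in> carrier (poly_ring n)"
  by (induction A rule: infinite_finite_induct) (auto simp: poly_ring_1 poly_ring_mult)

lemma gens_subset: "gens n r \<subseteq> carrier (poly_ring n)"
  unfolding gens_def
  by (auto simp del: power_Suc intro!: poly_ring_power poly_ring_mult poly_ring_sum var_in_poly_ring)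

lemma colored_ideal_ideal: "ideal (colored_ideal n r) (poly_ring n)"
  unfolding colored_ideal_def
  using ring.genideal_ideal[OF cring.axioms(1)[OF poly_ring_cring] gens_subset] .

lemma quotient_algebra_vectorspace:
  "vectorspace class_ring (quotient_algebra n r)"
proof -
  let ?R = "poly_ring n" and ?I = "colored_ideal n r"
  let ?Q = "?R Quot ?I"
  let ?V = "quotient_algebra n r"
  interpret I: ideal ?I ?R by (rule colored_ideal_ideal)
  have "cring ?Q" by (rule I.quotient_is_cring[OF poly_ring_cring])
  then interpret Q: cring ?Q .
  interpret h: ring_hom_ring ?R ?Q "\<lambda>f. ?I +>\<^bsub>?R\<^esub> f" by (rule I.rcos_ring_hom_ring)
  have V: "carrier ?V = carrier ?Q" "mult ?V = mult ?Q" "one ?V = one ?Q" "zero ?V = zero ?Q"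
    "add ?V = add ?Q"
    "smult ?V = (\<lambda>c X. residue_class n r (const_poly c) \<otimes>\<^bsub>?Q\<^esub> X)"
    by (simp_all add: quotient_algebra_def Let_def)
  have cl: "residue_class n r (const_poly c) \<in> carrier ?Q" for c
    unfolding residue_class_def using const_poly_in_poly_ring by (rule h.hom_closed)
  have cadd: "residue_class n r (const_poly (a + b)) =
      residue_class n r (const_poly a) \<oplus>\<^bsub>?Q\<^esub> residue_class n r (const_poly b)" for a b
    unfolding residue_class_def
    using h.hom_add[OF const_poly_in_poly_ring const_poly_in_poly_ring, of a b]
    by (simp add: const_poly_def single_add)
  have cmult: "residue_class n r (const_poly (a * b)) =
      residue_class n r (const_poly a) \<otimes>\<^bsub>?Q\<^esub> residue_class n r (const_poly b)" for a b
    unfolding residue_class_def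
    using h.hom_mult[OF const_poly_in_poly_ring const_poly_in_poly_ring, of a b]
    by (simp add: const_poly_def mult_single)
  have c1: "residue_class n r (const_poly 1) = \<one>\<^bsub>?Q\<^esub>"
    unfolding residue_class_def using h.hom_one by (simp add: const_poly_def)
  have "abelian_group ?V"
    by (rule abelian_groupI) (auto simp: V Q.a_ac intro: Q.l_neg Q.a_inv_closed)
  then have "Module.module class_ring ?V"
    by (intro moduleI)
       (simp_all add: V cl cadd cmult c1 Q.l_distr Q.r_distr Q.m_assoc class_cring.cring_axioms)
  then show ?thesis
    by (rule vectorspace.intro) (rule class_field.field_axioms)
qed

lemma corners_subset: "Q \<subseteq> A \<times> B \<Longrightarrow> corners Q \<subseteq> A \<times> B"
proof
  fix x assume Q: "Q \<subseteq> A \<times> B" and "x \<in> corners Q"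
  then obtain ps t where x: "x = (fst (ps ! Suc t), snd (ps ! t))" and ps: "set ps = Q"
    and t: "Suc t < length ps"
    unfolding corners_def by blast
  have "ps ! Suc t \<in> Q" "ps ! t \<in> Q"
    using ps t nth_mem[of "Suc t" ps] nth_mem[of t ps] by auto
  then show "x \<in> A \<times> B" using Q x by (auto simp: mem_Times_iff)
qed

lemma shadow_set_subset:
  assumes "P \<subseteq> A \<times> B" shows "shadow_set P \<subseteq> A \<times> B"
proof -
  have "((\<lambda>R. R - minimal_points R) ^^ k) P \<subseteq> P" for k
    by (induction k) auto
  then have "minimal_points (((\<lambda>R. R - minimal_points R) ^^ k) P) \<subseteq> A \<times> B" for k
    using assms unfolding minimal_points_def by blast
  then show ?thesis unfolding shadow_set_def using corners_subset by (meson UN_least)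
qed

lemma shadow_monomial_in_poly_ring:
  assumes "w \<in> colored_perms n r" shows "shadow_monomial n r w \<in> carrier (poly_ring n)"
proof -
  have col: "color_class n w l \<subseteq> {1..n} \<times> {1..n}" for l
    using assms permutes_in_image unfolding colored_perms_def color_class_def by fastforce
  have mon: "set_monomial S \<in> carrier (poly_ring n)" if "S \<subseteq> {1..n} \<times> {1..n}" for S
    unfolding set_monomial_def using that by (intro poly_ring_prod var_in_poly_ring) blast
  show ?thesis unfolding shadow_monomial_def
    by (intro poly_ring_mult poly_ring_prod poly_ring_power mon col shadow_set_subset)
qed

end

theory Submission
  imports Defs
begin

text \<open>
  Modulo the ideal every monomial vanishes unless its support is a rook placement and its exponents
  are at most \<open>r\<close>. Let \<open>Q\<close> be the cells with exponent below \<open>r\<close> and \<open>R\<close> those with exponent \<open>r\<close>;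
  \<open>R\<close> lives on the rows \<open>N\<close> and columns \<open>M\<close> not met by \<open>Q\<close>. Fix \<open>Q\<close> and compare placements \<open>R\<close>.

  If some chain \<open>K\<close> of \<open>R\<close> is longer than the number of columns of \<open>M\<close> that are free of \<open>R\<close> and not
  to the right of \<open>K\<close>, then by the pigeonhole principle the product, over the rows of \<open>K\<close>, of the
  partial row sums over the columns of \<open>K\<close> and the free columns to the right of \<open>K\<close> annihilates
  the rest of the monomial. This rewrites \<open>R\<close> through placements that come later in a fixed order;
  likewise with rows and columns exchanged.

  If no chain is that long, Viennot's shadow construction can be inverted: label the points of \<open>R\<close>
  by the shadow line they should be corners of, as large as the free rows and columns allow. Line
  \<open>a\<close> then enters at the \<open>a\<close>-th free row, turns at the points with label \<open>a\<close> and leaves at the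
  \<open>a\<close>-th free column. So \<open>R\<close> is the shadow set of a bijection from \<open>N\<close> to \<open>M\<close>, which together with
  \<open>Q\<close> is a colored permutation.
\<close>

section \<open>Straightening long chains\<close>

text \<open>The type \<open>cpoly\<close> has variables outside the grid, so the ideal absorbs only
  factors from the carrier of \<open>poly_ring n\<close>. Recording just that absorption keeps the
  type-class operations and big operators available for arithmetic modulo \<open>I\<close>.\<close>

locale subring_ideal =
  fixes C I :: "'a::comm_ring_1 set"
  assumes one_C: "1 \<in> C" and add_C: "\<And>f g. f \<in> C \<Longrightarrow> g \<in> C \<Longrightarrow> f + g \<in> C"
    and uminus_C: "\<And>f. f \<in> C \<Longrightarrow> - f \<in> C"
    and mult_C: "\<And>f g. f \<in> C \<Longrightarrow> g \<in> C \<Longrightarrow> f * g \<in> C"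
    and zero_I: "0 \<in> I" and add_I: "\<And>f g. f \<in> I \<Longrightarrow> g \<in> I \<Longrightarrow> f + g \<in> I"
    and mult_I: "\<And>c f. c \<in> C \<Longrightarrow> f \<in> I \<Longrightarrow> c * f \<in> I"
begin

lemma zero_C: "0 \<in> C"
  using add_C[OF one_C uminus_C[OF one_C]] by simp

lemma sum_C: "(\<And>x. x \<in> A \<Longrightarrow> f x \<in> C) \<Longrightarrow> sum f A \<in> C"
  by (induction A rule: infinite_finite_induct) (auto simp: zero_C add_C)

lemma prod_C: "(\<And>x. x \<in> A \<Longrightarrow> f x \<in> C) \<Longrightarrow> prod f A \<in> C"
  by (induction A rule: infinite_finite_induct) (auto simp: one_C mult_C)

lemma power_C: "f \<in> C \<Longrightarrow> f ^ k \<in> C"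
  by (induction k) (auto simp: one_C mult_C)

lemma uminus_I: "f \<in> I \<Longrightarrow> - f \<in> I"
  using mult_I[OF uminus_C[OF one_C], of f] by simp

lemma diff_I: "f \<in> I \<Longrightarrow> g \<in> I \<Longrightarrow> f - g \<in> I"
  using add_I[OF _ uminus_I] by fastforce

lemma sum_I: "(\<And>x. x \<in> A \<Longrightarrow> f x \<in> I) \<Longrightarrow> sum f A \<in> I"
  by (induction A rule: infinite_finite_induct) (auto simp: zero_I add_I)

lemma prod_I:
  assumes "finite A" "x \<in> A" "f x * m \<in> I" "\<And>y. y \<in> A \<Longrightarrow> f y \<in> C"
  shows "prod f A * m \<in> I"
proof -
  have "prod f A * m = prod f (A - {x}) * (f x * m)"
    using prod.remove[OF assms(1,2), of f] by (simp add: mult_ac)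
  then show ?thesis using assms by (auto intro!: mult_I prod_C)
qed

lemma prod_I2:
  assumes "finite A" "x \<in> A" "y \<in> A" "x \<noteq> y" "f x * f y \<in> I" "\<And>y. y \<in> A \<Longrightarrow> f y \<in> C"
  shows "prod f A \<in> I"
proof -
  have "prod f (A - {x}) * f x \<in> I"
    using assms by (intro prod_I[of _ y]) (auto simp: mult.commute)
  then show ?thesis
    using prod.remove[OF assms(1,2), of f] by (simp add: mult_ac)
qed

text \<open>In front of \<open>m\<close> each \<open>a s\<close> is congruent to
  \<open>- b s\<close>, and the factors are exchanged one at a time.\<close>

lemma prod_cong_ideal:
  assumes "finite S" "m \<in> C" "\<And>s. s \<in> S \<Longrightarrow> a s \<in> C" "\<And>s. s \<in> S \<Longrightarrow> b s \<in> C"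
    and "\<And>s. s \<in> S \<Longrightarrow> (a s + b s) * m \<in> I"
  shows "prod a S * m - (\<Prod>s\<in>S. - b s) * m \<in> I"
  using assms
proof (induction S rule: finite_induct)
  case empty
  then show ?case by (simp add: zero_I)
next
  case (insert s S)
  have "a s * (prod a S * m - (\<Prod>s\<in>S. - b s) * m) + (\<Prod>s\<in>S. - b s) * ((a s + b s) * m) \<in> I"
    using insert by (intro add_I mult_I[OF prod_C] mult_I[of "a s"] uminus_C) auto
  then show ?case using insert.hyps by (simp add: algebra_simps)
qed

end

section \<open>Rook placements, chains and the order of rewriting\<close>

definition below :: "nat \<times> nat \<Rightarrow> nat \<times> nat \<Rightarrow> bool" where
  "below p q \<longleftrightarrow> fst p < fst q \<and> snd p < snd q"

definition rook :: "(nat \<times> nat) set \<Rightarrow> bool" where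
  "rook R \<longleftrightarrow> inj_on fst R \<and> inj_on snd R"

lemma rook_subset: "rook R \<Longrightarrow> S \<subseteq> R \<Longrightarrow> rook S"
  unfolding rook_def by (blast intro: inj_on_subset)

lemma rook_Un:
  assumes "rook R" "rook S" "fst ` R \<inter> fst ` S = {}" "snd ` R \<inter> snd ` S = {}"
  shows "rook (R \<union> S)"
proof -
  have "f ` (R - S) \<inter> f ` (S - R) = {}" if "f ` R \<inter> f ` S = {}" for f :: "nat \<times> nat \<Rightarrow> nat"
    using that by blast
  then show ?thesis using assms unfolding rook_def inj_on_Un by blast
qed

definition chain :: "(nat \<times> nat) set \<Rightarrow> bool" where
  "chain K \<longleftrightarrow> (\<forall>p\<in>K. \<forall>q\<in>K. p = q \<or> below p q \<or> below q p)"

text \<open>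
  This form of "the first difference belongs to \<open>R\<close>" is invariant under exchanging rows and columns.
\<close>

definition precedes :: "(nat \<times> nat) set \<Rightarrow> (nat \<times> nat) set \<Rightarrow> bool" where
  "precedes R R' \<longleftrightarrow> (\<exists>q\<in>R - R'. \<forall>q'\<in>R' - R. fst q \<le> fst q' \<and> snd q \<le> snd q')"

text \<open>Take \<open>q\<close> in the first row of \<open>K\<close> that \<open>g\<close> moves
  to a new column. The columns of \<open>K\<close> left of \<open>q\<close> belong to earlier rows
  of the chain, which keep them, so by injectivity no moved row gets a column left of
  \<open>q\<close>.\<close>

lemma reroute_precedes:
  assumes R: "rook R" and K: "K \<subseteq> R" "chain K" and "finite R"
    and y: "\<And>p. p \<in> K \<Longrightarrow> snd p \<le> y"
    and g: "g ` fst ` K \<subseteq> snd ` K \<union> {j. y < j}" "inj_on g (fst ` K)"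
    and R': "R' = (R - K) \<union> (\<lambda>s. (s, g s)) ` fst ` K" and ne: "R' \<noteq> R"
  shows "precedes R R'"
proof -
  define D where "D = {p \<in> K. g (fst p) \<noteq> snd p}"
  have finD: "finite D" using K(1) \<open>finite R\<close> unfolding D_def by (auto intro: finite_subset)
  have Kg: "(\<lambda>s. (s, g s)) ` fst ` K = (\<lambda>p. (fst p, g (fst p))) ` K" by (auto simp: image_image)
  have "D \<noteq> {}"
  proof
    assume "D = {}"
    then have "(\<lambda>p. (fst p, g (fst p))) ` K = id ` K" unfolding D_def by (intro image_cong) auto
    then have "R' = R" using R' Kg K(1) by auto
    then show False using ne by simp
  qed
  then have "finite (fst ` D)" "fst ` D \<noteq> {}" using finD by auto
  then have "Min (fst ` D) \<in> fst ` D" by (rule Min_in)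
  then obtain q where q: "q \<in> D" and qm: "fst q = Min (fst ` D)" by auto
  have qmin: "fst q \<le> fst p" if "p \<in> D" for p
    using that finD by (simp add: qm)
  have injK: "inj_on fst K" "inj_on snd K" using R K(1) unfolding rook_def by (auto intro: inj_on_subset)
  have qK: "q \<in> K" and gq: "g (fst q) \<noteq> snd q" using q unfolding D_def by auto
  have smaller: "g (fst p) = snd p" if "p \<in> K" "fst p < fst q" for p
    using qmin[of p] that unfolding D_def by force
  have ge: "snd q \<le> g (fst p)" if p: "p \<in> K" "fst q \<le> fst p" for p
  proof (cases "g (fst p) \<in> snd ` K")
    case True
    then obtain p' where p': "p' \<in> K" "g (fst p) = snd p'" by auto
    show ?thesis
    proof (rule ccontr)
      assume "\<not> ?thesis"
      then have lt: "snd p' < snd q" using p' by simp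
      then have "fst p' < fst q" using K(2) p'(1) qK unfolding chain_def below_def by fastforce
      then have "g (fst p') = snd p'" using smaller p' by simp
      then have "fst p' = fst p" using p' inj_onD[OF g(2), of "fst p'" "fst p"] p(1) by simp
      then show False using \<open>fst p' < fst q\<close> p(2) by simp
    qed
  next
    case False
    then have "y < g (fst p)" using g(1) p(1) by auto
    then show ?thesis using y[OF qK] by simp
  qed
  have "q \<notin> R'"
  proof
    assume "q \<in> R'"
    then obtain p where "p \<in> K" "q = (fst p, g (fst p))" using R' qK Kg by auto
    then show False using gq by auto
  qed
  moreover have "fst q \<le> fst q' \<and> snd q \<le> snd q'" if "q' \<in> R' - R" for q'
  proof -
    have "q' \<in> (\<lambda>p. (fst p, g (fst p))) ` K" using that R' Kg by blast
    then obtain p where p: "p \<in> K" "q' = (fst p, g (fst p))" by blast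
    have "p \<in> D" using p that K(1) unfolding D_def by (cases p) auto
    then show ?thesis using qmin ge p by auto
  qed
  ultimately show ?thesis unfolding precedes_def using qK K(1) by blast
qed

text \<open>\<open>N\<close> and \<open>M\<close> are the rows and columns available to
  \<open>R\<close>, \<open>z p\<close> plays the \<open>r\<close>-th power of the variable at
  \<open>p\<close>, and \<open>m\<close> the remaining factors of the monomial. Leaving
  \<open>z\<close> abstract lets the transposed grid be treated too. \<open>W\<close> is the target
  set, and \<open>IH\<close> supplies the placements later in the order.\<close>

lemma (in subring_ideal) straighten:
  fixes z :: "nat \<times> nat \<Rightarrow> 'a"
  assumes fin: "finite G" and NM: "N \<subseteq> G" "M \<subseteq> G" and R: "R \<subseteq> N \<times> M" "rook R"
    and zC: "\<And>p. p \<in> G \<times> G \<Longrightarrow> z p \<in> C"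
    and line: "\<And>i. i \<in> G \<Longrightarrow> (\<Sum>j\<in>G. z (i, j)) \<in> I"
    and meet: "\<And>i i' j. i \<in> G \<Longrightarrow> i' \<in> G \<Longrightarrow> j \<in> G \<Longrightarrow> i \<noteq> i' \<Longrightarrow> z (i, j) * z (i', j) \<in> I"
    and mC: "m \<in> C" and kill: "\<And>i j. i \<in> G \<Longrightarrow> j \<in> G - M \<Longrightarrow> z (i, j) * m \<in> I"
    and K: "K \<subseteq> R" "chain K" and y: "\<And>p. p \<in> K \<Longrightarrow> snd p \<le> y"
    and card: "card {j \<in> M - snd ` R. j \<le> y} < card K"
    and W: "I \<subseteq> W" "\<And>f g. f \<in> W \<Longrightarrow> g \<in> W \<Longrightarrow> f + g \<in> W" "\<And>f. f \<in> W \<Longrightarrow> - f \<in> W"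
    and IH: "\<And>R'. R' \<subseteq> N \<times> M \<Longrightarrow> rook R' \<Longrightarrow> precedes R R' \<Longrightarrow> prod z R' * m \<in> W"
  shows "prod z R * m \<in> W"
proof -
  \<comment> \<open>\<open>T\<close> and \<open>B\<close> split the columns not killed by \<open>m'\<close>; since \<open>B\<close> is smaller than \<open>S\<close>,
    the product of the row sums over \<open>B\<close> vanishes modulo \<open>I\<close>, hence so does that over \<open>T\<close>.\<close>
  define S where "S = fst ` K"
  define B where "B = {j \<in> M - snd ` R. j \<le> y}"
  define T where "T = snd ` K \<union> {j \<in> M - snd ` R. y < j}"
  define m' where "m' = prod z (R - K) * m"
  have finNM: "finite N" "finite M" using fin NM by (auto intro: finite_subset)
  then have finR: "finite R" using R(1) finite_subset by blast
  have finK: "finite K" using K(1) finR finite_subset by blast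
  have RG: "R \<subseteq> G \<times> G" using R(1) NM by blast
  have SN: "S \<subseteq> N" "S \<subseteq> G" and TM: "T \<subseteq> M" "T \<subseteq> G" and BM: "B \<subseteq> M" "B \<subseteq> G"
    using subsetD[OF R(1)] subsetD[OF K(1)] NM unfolding S_def T_def B_def by fastforce+
  have finS: "finite S" and finT: "finite T" and finB: "finite B"
    using SN TM BM fin finite_subset by blast+
  have cardS: "card S = card K" unfolding S_def
    using R(2) K(1) unfolding rook_def by (intro card_image) (auto intro: inj_on_subset)
  have m'C: "m' \<in> C" unfolding m'_def using RG by (intro mult_C prod_C zC mC) auto
  have zSG: "z (s, j) \<in> C" if "s \<in> S" "j \<in> G" for s j using that SN zC by auto
  have TB: "T \<inter> B = {}" "T \<union> B = M - snd ` (R - K)"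
  proof -
    show "T \<inter> B = {}" unfolding T_def B_def using K(1) by auto
    have "snd ` K \<inter> snd ` (R - K) = {}"
      using K(1) R(2) unfolding rook_def by (auto dest!: inj_onD)
    moreover have "snd ` R = snd ` K \<union> snd ` (R - K)" using K(1) by auto
    moreover have "snd ` R \<subseteq> M" using R(1) by auto
    moreover have "T \<union> B = snd ` K \<union> (M - snd ` R)" unfolding T_def B_def by auto
    moreover have "A \<union> (M - (A \<union> L)) = M - L" if "A \<inter> L = {}" "A \<union> L \<subseteq> M" for A L :: "nat set"
      using that by blast
    ultimately show "T \<union> B = M - snd ` (R - K)" by metis
  qed
  have cong: "(\<Prod>s\<in>S. \<Sum>j\<in>T. z (s, j)) * m' - (\<Prod>s\<in>S. - (\<Sum>j\<in>B. z (s, j))) * m' \<in> I"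
  proof (rule prod_cong_ideal[OF finS m'C])
    fix s assume s: "s \<in> S"
    show "(\<Sum>j\<in>T. z (s, j)) \<in> C" "(\<Sum>j\<in>B. z (s, j)) \<in> C"
      using s TM BM by (auto intro!: sum_C zSG)
    \<comment> \<open>A column outside \<open>T\<close> and \<open>B\<close> is either occupied by a
      point of \<open>R - K\<close>, in a row other than \<open>s\<close>, or lies outside
      \<open>M\<close>; in both cases \<open>m'\<close> kills \<open>z (s, j)\<close>.\<close>
    have rest: "z (s, j) * m' \<in> I" if j: "j \<in> G - (T \<union> B)" for j
    proof (cases "j \<in> M")
      case True
      then have "j \<in> snd ` (R - K)" using j TB by auto
      then obtain p where p: "p \<in> R - K" "snd p = j" by auto
      have "fst p \<noteq> s"
      proof
        assume "fst p = s"
        then obtain p' where "p' \<in> K" "fst p' = fst p" using s unfolding S_def by auto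
        then show False using p K(1) R(2) unfolding rook_def by (auto dest!: inj_onD)
      qed
      then have "z p * z (s, j) \<in> I"
        using meet[of "fst p" s j] p s SN(2) j subsetD[OF RG, of p] by (auto simp: mem_Times_iff)
      then have "prod z (R - K) * z (s, j) \<in> I"
        using p finR RG by (intro prod_I[of _ p]) (auto intro: zC)
      then have "m * (prod z (R - K) * z (s, j)) \<in> I" by (rule mult_I[OF mC])
      then show ?thesis unfolding m'_def by (simp add: mult_ac)
    next
      case False
      then have "z (s, j) * m \<in> I" using j s SN kill by auto
      then have "prod z (R - K) * (z (s, j) * m) \<in> I"
        using RG zC by (intro mult_I[OF prod_C]) auto
      then show ?thesis unfolding m'_def by (simp add: mult_ac)
    qed
    have "(\<Sum>j\<in>G. z (s, j)) = (\<Sum>j\<in>T \<union> B. z (s, j)) + (\<Sum>j\<in>G - (T \<union> B). z (s, j))"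
      using sum.subset_diff[of "T \<union> B" G] TM BM fin by (simp add: add.commute)
    also have "(\<Sum>j\<in>T \<union> B. z (s, j)) = (\<Sum>j\<in>T. z (s, j)) + (\<Sum>j\<in>B. z (s, j))"
      using TB(1) finT finB by (intro sum.union_disjoint) auto
    finally have "((\<Sum>j\<in>T. z (s, j)) + (\<Sum>j\<in>B. z (s, j))) * m' =
        m' * (\<Sum>j\<in>G. z (s, j)) - (\<Sum>j\<in>G - (T \<union> B). z (s, j) * m')"
      by (simp add: algebra_simps sum_distrib_left)
    also have "\<dots> \<in> I"
      using s SN rest by (intro diff_I mult_I[OF m'C line] sum_I) auto
    finally show "((\<Sum>j\<in>T. z (s, j)) + (\<Sum>j\<in>B. z (s, j))) * m' \<in> I" .
  qed
  have noninj: "(\<Prod>s\<in>S. z (s, g s)) \<in> I" if g: "g ` S \<subseteq> G" "\<not> inj_on g S" for g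
  proof -
    obtain s s' where s: "s \<in> S" "s' \<in> S" "s \<noteq> s'" "g s = g s'" using g unfolding inj_on_def by auto
    have "z (s, g s) * z (s', g s') \<in> I" using meet[of s s' "g s"] s SN(2) g(1) by auto
    then show ?thesis using s finS g(1) by (intro prod_I2[of S s s']) (auto intro!: zSG)
  qed
  have "(\<Prod>s\<in>S. \<Sum>j\<in>B. z (s, j)) = (\<Sum>g\<in>PiE S (\<lambda>_. B). \<Prod>s\<in>S. z (s, g s))"
    using finS finB by (intro prod_sum_PiE) auto
  also have "\<dots> \<in> I"
  proof (rule sum_I, rule noninj)
    fix g assume g: "g \<in> PiE S (\<lambda>_. B)"
    then show "g ` S \<subseteq> G" using BM by auto
    have "card B < card S" using card cardS unfolding B_def by simp
    then show "\<not> inj_on g S" using card_inj_on_le[of g S B] g finB by (auto simp: PiE_iff)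
  qed
  finally have "(- 1) ^ card S * m' * (\<Prod>s\<in>S. \<Sum>j\<in>B. z (s, j)) \<in> I"
    by (intro mult_I mult_C power_C uminus_C one_C m'C)
  then have "(\<Prod>s\<in>S. - (\<Sum>j\<in>B. z (s, j))) * m' \<in> I"
    by (simp add: prod_uminus mult_ac)
  from add_I[OF cong this] have "(\<Prod>s\<in>S. \<Sum>j\<in>T. z (s, j)) * m' \<in> I" by simp
  also have "(\<Prod>s\<in>S. \<Sum>j\<in>T. z (s, j)) = (\<Sum>g\<in>PiE S (\<lambda>_. T). \<Prod>s\<in>S. z (s, g s))"
    using finS finT by (intro prod_sum_PiE) auto
  finally have total: "(\<Sum>g\<in>PiE S (\<lambda>_. T). (\<Prod>s\<in>S. z (s, g s)) * m') \<in> I"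
    by (simp add: sum_distrib_right)
  \<comment> \<open>The term of \<open>g0\<close> is the original monomial.\<close>
  define g0 where "g0 = (\<lambda>s\<in>S. snd (the_inv_into K fst s))"
  have injK: "inj_on fst K" using R(2) K(1) unfolding rook_def by (auto intro: inj_on_subset)
  have g0: "g0 (fst p) = snd p" if "p \<in> K" for p
    using that the_inv_into_f_f[OF injK that] unfolding g0_def S_def by simp
  have g0_PiE: "g0 \<in> PiE S (\<lambda>_. T)" unfolding PiE_iff
    using g0 by (auto simp: S_def T_def g0_def)
  have term_eq: "(\<Prod>s\<in>S. z (s, g s)) * m' = prod z ((R - K) \<union> (\<lambda>s. (s, g s)) ` S) * m"
    and graph_disj: "(R - K) \<inter> (\<lambda>s. (s, g s)) ` S = {}" for g
  proof -
    show disj: "(R - K) \<inter> (\<lambda>s. (s, g s)) ` S = {}"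
    proof -
      have "fst p \<notin> S" if "p \<in> R - K" for p
        using that K(1) R(2) unfolding rook_def S_def by (auto dest!: inj_onD)
      then show ?thesis by fastforce
    qed
    have "(\<Prod>s\<in>S. z (s, g s)) = prod z ((\<lambda>s. (s, g s)) ` S)"
      by (subst prod.reindex) (auto simp: inj_on_def)
    then show "(\<Prod>s\<in>S. z (s, g s)) * m' = prod z ((R - K) \<union> (\<lambda>s. (s, g s)) ` S) * m"
      using disj finR finS by (simp add: m'_def prod.union_disjoint mult_ac)
  qed
  have graph_g0: "(\<lambda>s. (s, g0 s)) ` S = K"
    unfolding S_def image_image using g0 by (auto simp: image_iff) 
  \<comment> \<open>A non-injective map puts two factors into one column, so its term is in
    \<open>I\<close>; an injective one describes a rook placement, later in the order because it
    differs from \<open>R\<close>.\<close>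
  have others: "(\<Prod>s\<in>S. z (s, g s)) * m' \<in> W" if g: "g \<in> PiE S (\<lambda>_. T)" "g \<noteq> g0" for g
  proof (cases "inj_on g S")
    case False
    have "m' * (\<Prod>s\<in>S. z (s, g s)) \<in> I"
      using False g TM by (intro mult_I m'C noninj) auto
    then show ?thesis using W(1) by (auto simp: mult.commute)
  next
    case True
    define R' where "R' = (R - K) \<union> (\<lambda>s. (s, g s)) ` S"
    have gT: "g s \<in> T" if "s \<in> S" for s using g that by auto
    have "R' \<noteq> R"
    proof
      assume "R' = R"
      then have graph: "(\<lambda>s. (s, g s)) ` S = K" using graph_disj[of g] K(1) unfolding R'_def by blast
      have "g s = g0 s" if "s \<in> S" for s
      proof -
        have "(s, g s) \<in> K" unfolding graph[symmetric] using that by (rule imageI)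
        then show ?thesis using g0 by fastforce
      qed
      then show False using g g0_PiE by (auto intro: PiE_ext)
    qed
    have T_disj: "T \<inter> snd ` (R - K) = {}" using TB(2) by blast
    have S_disj: "S \<inter> fst ` (R - K) = {}"
      using K(1) R(2) unfolding S_def rook_def by (auto dest!: inj_onD)
    have img: "fst ` (\<lambda>s. (s, g s)) ` S = S" "snd ` (\<lambda>s. (s, g s)) ` S = g ` S"
      by (auto simp: image_image)
    have "rook R'" unfolding R'_def
    proof (rule rook_Un)
      show "rook (R - K)" using R(2) rook_subset by blast
      show "rook ((\<lambda>s. (s, g s)) ` S)" using True by (auto simp: rook_def inj_on_def)
      show "fst ` (R - K) \<inter> fst ` (\<lambda>s. (s, g s)) ` S = {}" using S_disj unfolding img by (simp only: Int_commute)
      show "snd ` (R - K) \<inter> snd ` (\<lambda>s. (s, g s)) ` S = {}" 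
      proof -
        have "g ` S \<subseteq> T" using gT by (rule image_subsetI)
        then show ?thesis unfolding img using T_disj by (simp only: disjoint_iff) fast
      qed
    qed
    moreover have "R' \<subseteq> N \<times> M" using R(1) gT SN TM unfolding R'_def by auto
    moreover have "precedes R R'"
    proof (rule reroute_precedes[OF R(2) K finR y _ _ R'_def[unfolded S_def] \<open>R' \<noteq> R\<close>])
      show "g ` fst ` K \<subseteq> snd ` K \<union> {j. y < j}" using gT unfolding S_def T_def by auto
      show "inj_on g (fst ` K)" using True unfolding S_def .
    qed
    ultimately show ?thesis using IH term_eq[of g] unfolding R'_def by simp
  qed
  have sum_W: "sum f A \<in> W" if "\<And>x. x \<in> A \<Longrightarrow> f x \<in> W" for f :: "(nat \<Rightarrow> nat) \<Rightarrow> 'a" and A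
    using that zero_I W by (induction A rule: infinite_finite_induct) auto
  have "finite (PiE S (\<lambda>_. T))" using finS finT by (intro finite_PiE) auto
  then have "prod z R * m = (\<Sum>g\<in>PiE S (\<lambda>_. T). (\<Prod>s\<in>S. z (s, g s)) * m') +
      - (\<Sum>g\<in>PiE S (\<lambda>_. T) - {g0}. (\<Prod>s\<in>S. z (s, g s)) * m')"
    using sum.remove[OF _ g0_PiE, of "\<lambda>g. (\<Prod>s\<in>S. z (s, g s)) * m'"] term_eq[of g0] graph_g0 K(1)
    by (simp add: Un_absorb2)
  also have "\<dots> \<in> W"
    by (rule W(2)[OF subsetD[OF W(1) total] W(3)[OF sum_W]]) (use others in auto)
  finally show ?thesis .
qed

section \<open>Shadow lines\<close>

lemma below_trans: "below p q \<Longrightarrow> below q s \<Longrightarrow> below p s"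
  by (auto simp: below_def)

lemma minimal_points_alt: "minimal_points P = {p \<in> P. \<not> (\<exists>q\<in>P. below q p)}"
  by (force simp: minimal_points_def below_def)

text \<open>The list in \<open>corners\<close> is only asserted to exist. Its rows are the sorted
  rows of the set, and a row determines its point, so it can only be
  \<open>zip xs ys\<close>.\<close>

lemma corners_zip:
  assumes len: "length ys = length xs" and xs: "sorted_wrt (<) xs"
  shows "corners (set (zip xs ys)) = {(xs ! Suc t, ys ! t) | t. Suc t < length xs}"
proof -
  have dist: "distinct xs" using xs by (simp add: strict_sorted_iff)
  have uniq: "ps = zip xs ys"
    if ps: "set ps = set (zip xs ys)" "sorted_wrt (\<lambda>p q. fst p < fst q) ps" for ps
  proof -
    have "set (map fst ps) = fst ` set (zip xs ys)" using ps by simp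
    also have "\<dots> = set xs" using len by (metis list.set_map map_fst_zip)
    finally have fst_ps: "map fst ps = xs"
      using ps(2) xs by (intro strict_sorted_equal) (auto simp: sorted_wrt_map)
    then have len': "length ps = length xs" by auto
    show ?thesis
    proof (rule nth_equalityI)
      show "length ps = length (zip xs ys)" using len len' by simp
      fix t assume t: "t < length ps"
      then have "ps ! t \<in> set (zip xs ys)" using ps by (metis nth_mem)
      then obtain k where k: "k < length xs" "ps ! t = (xs ! k, ys ! k)" by (auto simp: set_zip)
      moreover have "fst (ps ! t) = xs ! t" using t fst_ps by (metis nth_map)
      ultimately have "k = t" using dist t len' by (simp add: nth_eq_iff_index_eq)
      then show "ps ! t = zip xs ys ! t" using k len by simp
    qed
  qed
  have "sorted_wrt (\<lambda>p q. fst p < fst q) (zip xs ys)"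
    using xs len by (simp add: sorted_wrt_iff_nth_less)
  then have "corners (set (zip xs ys)) =
      {(fst (zip xs ys ! Suc t), snd (zip xs ys ! t)) | t. Suc t < length (zip xs ys)}"
    unfolding corners_def using uniq by blast
  also have "\<dots> = {(xs ! Suc t, ys ! t) | t. Suc t < length xs}"
    using len by (intro Collect_cong ex_cong1) auto
  finally show ?thesis .
qed

text \<open>This recognises the rounds of the shadow construction from their properties. By
  transitivity every point of a later layer has a point of \<open>L k\<close> below it, so for
  \<open>k < m\<close> the minimal points of what remains after \<open>k\<close> rounds are exactly
  \<open>L k\<close>.\<close>

lemma shadow_set_levels:
  assumes anti: "\<And>a p q. a < m \<Longrightarrow> p \<in> L a \<Longrightarrow> q \<in> L a \<Longrightarrow> \<not> below p q"
    and dom: "\<And>a p. Suc a < m \<Longrightarrow> p \<in> L (Suc a) \<Longrightarrow> \<exists>q\<in>L a. below q p"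
  shows "shadow_set (\<Union>a<m. L a) = (\<Union>a<m. corners (L a))"
proof -
  have dom': "\<exists>q\<in>L a. below q p" if "a < b" "b < m" "p \<in> L b" for a b p
    using that
  proof (induction b arbitrary: p)
    case (Suc b)
    then obtain q where q: "q \<in> L b" "below q p" using dom by blast
    show ?case
    proof (cases "a = b")
      case False
      then obtain q' where "q' \<in> L a" "below q' q" using Suc.IH[of q] Suc.prems q by auto
      then show ?thesis using q below_trans by blast
    qed (use q in blast)
  qed simp
  have min: "minimal_points (\<Union>a\<in>{k..<m}. L a) = L k" if "k < m" for k
  proof
    show "minimal_points (\<Union>a\<in>{k..<m}. L a) \<subseteq> L k"
    proof
      fix p assume p: "p \<in> minimal_points (\<Union>a\<in>{k..<m}. L a)"
      then obtain a where a: "k \<le> a" "a < m" "p \<in> L a" unfolding minimal_points_alt by auto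
      have "\<not> (\<exists>q\<in>L k. below q p)" using p that unfolding minimal_points_alt by auto
      then have "a = k" using dom'[of k a p] a by (auto simp: le_less)
      then show "p \<in> L k" using a by simp
    qed
    show "L k \<subseteq> minimal_points (\<Union>a\<in>{k..<m}. L a)"
    proof
      fix p assume p: "p \<in> L k"
      have "\<not> below q p" if q: "q \<in> L a" "k \<le> a" "a < m" for q a
      proof (cases "a = k")
        case False
        then obtain q' where "q' \<in> L k" "below q' q" using dom'[of k a q] q by (auto simp: le_less)
        then show ?thesis using anti[of k q' p] p \<open>k < m\<close> below_trans by blast
      qed (use anti[of k q p] p q in auto)
      then show "p \<in> minimal_points (\<Union>a\<in>{k..<m}. L a)"
        using p \<open>k < m\<close> unfolding minimal_points_alt by auto
    qed
  qed
  have rounds: "((\<lambda>R. R - minimal_points R) ^^ k) (\<Union>a<m. L a) = (\<Union>a\<in>{k..<m}. L a)" for k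
  proof (induction k)
    case 0
    then show ?case by (simp add: lessThan_atLeast0)
  next
    case (Suc k)
    show ?case
    proof (cases "k < m")
      case True
      have later: "p \<notin> L k" if "p \<in> L a" "Suc k \<le> a" "a < m" for p a
        using dom'[of k a p] that anti[of k _ p] True by auto
      then have "(\<Union>a\<in>{k..<m}. L a) - L k = (\<Union>a\<in>{Suc k..<m}. L a)"
      proof -
        have "{k..<m} = insert k {Suc k..<m}" using True by auto
        moreover have "(\<Union>a\<in>{Suc k..<m}. L a) \<inter> L k = {}" using later by auto
        ultimately show ?thesis by auto
      qed
      then show ?thesis using Suc min[OF True] by simp
    qed (use Suc in simp)
  qed
  have empty: "corners (minimal_points {}) = {}"
    by (auto simp: corners_def minimal_points_def)
  \<comment> \<open>From round \<open>m\<close> on nothing is left, and such rounds contribute no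
    corners.\<close>
  have "corners (minimal_points (\<Union>a\<in>{k..<m}. L a)) = (if k < m then corners (L k) else {})" for k
    using min empty by simp
  then show ?thesis unfolding shadow_set_def rounds by (auto split: if_splits)
qed

section \<open>Inverting the shadow construction\<close>

text \<open>The witness \<open>h q\<close> is the largest size of a chain lying strictly below
  \<open>q\<close>. Adding \<open>q\<close> on top gives a chain with one more point, which
  \<open>bound\<close> compares with \<open>E q\<close>.\<close>

lemma height_labelling:
  assumes "finite R"
    and bound: "\<And>K q. K \<subseteq> R \<Longrightarrow> chain K \<Longrightarrow> q \<in> K \<Longrightarrow> (\<And>p. p \<in> K \<Longrightarrow> p = q \<or> below p q) \<Longrightarrow>
      card K \<le> E q"
  shows "\<exists>h. (\<forall>p\<in>R. \<forall>q\<in>R. below p q \<longrightarrow> h p < h q) \<and> (\<forall>q\<in>R. h q < E q)"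
proof -
  define A where "A = (\<lambda>q. {K. K \<subseteq> R \<and> chain K \<and> (\<forall>p\<in>K. below p q)})"
  define h where "h = (\<lambda>q. Max (card ` A q))"
  have finA: "finite (A q)" for q unfolding A_def using assms(1) by simp
  have "{} \<in> A q" for q unfolding A_def chain_def by simp
  then have neA: "A q \<noteq> {}" for q by blast
  have ex: "\<exists>K\<in>A q. h q = card K" for q
  proof -
    have "h q \<in> card ` A q" unfolding h_def using finA neA by (intro Max_in) auto
    then show ?thesis by blast
  qed
  have ge: "card K \<le> h q" if "K \<in> A q" for K q
    using that finA unfolding h_def by simp
  have step: "insert q K \<subseteq> R \<and> chain (insert q K) \<and> card (insert q K) = Suc (card K) \<and>
      (\<forall>p\<in>insert q K. p = q \<or> below p q)" if "K \<in> A q" "q \<in> R" for K q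
  proof -
    have "q \<notin> K" using that unfolding A_def below_def by auto
    moreover have "finite K" using that assms(1) unfolding A_def by (auto intro: finite_subset)
    moreover have "K \<subseteq> R" "chain K" "\<forall>p\<in>K. below p q" using that unfolding A_def by blast+
    moreover from this have "chain (insert q K)" unfolding chain_def by fast
    ultimately show ?thesis using that(2) by simp
  qed
  have "h p < h q" if pq: "p \<in> R" "q \<in> R" "below p q" for p q
  proof -
    obtain K where K: "K \<in> A p" "h p = card K" using ex by blast
    have "below p' q" if "p' \<in> insert p K" for p'
      using step[OF K(1) pq(1)] that pq(3) below_trans by metis
    then have "insert p K \<in> A q"
      using step[OF K(1) pq(1)] unfolding A_def by simp
    then show ?thesis using ge[of "insert p K" q] step[OF K(1) pq(1)] K(2) by simp
  qed
  moreover have "h q < E q" if "q \<in> R" for q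
  proof -
    obtain K where K: "K \<in> A q" "h q = card K" using ex by blast
    have "card (insert q K) \<le> E q" using step[OF K(1) that] by (intro bound) auto
    then show ?thesis using step[OF K(1) that] K(2) by simp
  qed
  ultimately show ?thesis by blast
qed

text \<open>Among the \<open>ok\<close> labellings that increase along \<open>below\<close>, take
  one with the largest sum; \<open>bound\<close> makes the sums bounded. An \<open>ok\<close> raise
  of \<open>h q\<close> by one that is not blocked by a larger point with that label would increase
  the sum.\<close>

lemma maximal_labelling:
  assumes "finite R"
    and h0: "\<And>p q. p \<in> R \<Longrightarrow> q \<in> R \<Longrightarrow> below p q \<Longrightarrow> h0 p < h0 q" "\<And>q. q \<in> R \<Longrightarrow> ok q (h0 q)"
    and bound: "\<And>q k. q \<in> R \<Longrightarrow> ok q k \<Longrightarrow> k < (m::nat)"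
  shows "\<exists>h. (\<forall>p\<in>R. \<forall>q\<in>R. below p q \<longrightarrow> h p < h q) \<and> (\<forall>q\<in>R. ok q (h q)) \<and>
    (\<forall>q\<in>R. ok q (Suc (h q)) \<longrightarrow> (\<exists>q'\<in>R. below q q' \<and> h q' = Suc (h q)))"
proof -
  define good where "good = (\<lambda>h. (\<forall>p\<in>R. \<forall>q\<in>R. below p q \<longrightarrow> h p < h q) \<and> (\<forall>q\<in>R. ok q (h q)))"
  have "sum h R < Suc (card R * m)" if "good h" for h
  proof -
    have "h q \<le> m" if "q \<in> R" for q
      using bound[OF that, of "h q"] \<open>good h\<close> that unfolding good_def by (simp add: less_imp_le)
    then show ?thesis using sum_bounded_above[of R h m] by (simp add: less_Suc_eq_le)
  qed
  moreover have "good h0" using h0 unfolding good_def by blast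
  ultimately obtain h where h: "good h" and max: "\<And>g. good g \<Longrightarrow> sum g R \<le> sum h R"
    using ex_has_greatest_nat[of good h0 "\<lambda>h. sum h R" "Suc (card R * m)"] by blast
  have "\<exists>q'\<in>R. below q q' \<and> h q' = Suc (h q)" if q: "q \<in> R" "ok q (Suc (h q))" for q
  proof (rule ccontr)
    assume none: "\<not> ?thesis"
    have "good (h(q := Suc (h q)))"
      unfolding good_def
    proof (intro conjI ballI impI)
      fix p p' assume p: "p \<in> R" "p' \<in> R" "below p p'"
      then have lt: "h p < h p'" and "p \<noteq> p'" using h unfolding good_def below_def by auto
      moreover have "Suc (h q) < h p'" if "p = q"
        using lt none p that by (metis Suc_lessI)
      ultimately show "(h(q := Suc (h q))) p < (h(q := Suc (h q))) p'" by auto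
    next
      fix p assume "p \<in> R"
      then show "ok p ((h(q := Suc (h q))) p)" using h q unfolding good_def by auto
    qed
    from max[OF this] have "sum (h(q := Suc (h q))) R \<le> sum h R" .
    moreover have "sum (h(q := Suc (h q))) R = Suc (sum h R)"
      using q(1) assms(1) by (simp add: sum.remove[of R q])
    ultimately show False by simp
  qed
  then show ?thesis using h unfolding good_def by blast
qed

section \<open>Construction of the shadow lines\<close>

lemma sorted_by_row:
  assumes "finite C" "inj_on fst C"
  shows "\<exists>ps :: (nat \<times> nat) list. set ps = C \<and> sorted_wrt (\<lambda>p q. fst p < fst q) ps"
proof -
  obtain qs where qs: "set qs = C" "distinct qs" using finite_distinct_list[OF assms(1)] by blast
  let ?ps = "sort_key fst qs"
  have "distinct (map fst ?ps)" using qs assms(2) by (simp add: distinct_map)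
  then have "sorted_wrt (<) (map fst ?ps)" by (simp add: strict_sorted_iff)
  then show ?thesis using qs by (intro exI[of _ ?ps]) (simp add: sorted_wrt_map)
qed

text \<open>The pairs in \<open>zip xs ys\<close> are the points of a staircase line with corners
  \<open>(xs ! Suc t, ys ! t)\<close>. The last index \<open>t\<close> with row before
  \<open>i\<close> works: the corner after it, or the final column of the line, forces its column to
  be before \<open>j\<close>.\<close>

lemma zip_dominates:
  assumes "length ys = length xs" "xs \<noteq> []" "xs ! 0 < i" "last ys < j"
    and "\<And>t. Suc t < length xs \<Longrightarrow> i \<le> xs ! Suc t \<Longrightarrow> ys ! t < j"
  shows "\<exists>q\<in>set (zip xs ys). below q (i, j)"
proof -
  define t where "t = Max {t. t < length xs \<and> xs ! t < i}"
  have fin: "finite {t. t < length xs \<and> xs ! t < i}" by simp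
  have "0 \<in> {t. t < length xs \<and> xs ! t < i}" using assms(2,3) by simp
  then have t: "t < length xs" "xs ! t < i" using Max_in[OF fin] unfolding t_def by blast+
  have "ys ! t < j"
  proof (cases "Suc t < length xs")
    case True
    have "i \<le> xs ! Suc t"
    proof (rule ccontr)
      assume "\<not> ?thesis"
      then have "Suc t \<le> t" using True Max_ge[OF fin, of "Suc t"] unfolding t_def by simp
      then show False by simp
    qed
    then show ?thesis using assms(5) True by blast
  next
    case False
    then have "t = length ys - 1" using t assms(1) by simp
    then show ?thesis using assms(1,2,4) last_conv_nth[of ys] by fastforce
  qed
  then show ?thesis using t assms(1) unfolding below_def
    by (intro bexI[of _ "(xs ! t, ys ! t)"]) (auto simp: set_zip)
qed


lemma shadow_preimage:
  assumes fin: "finite N" "finite M" and card: "card N = card M"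
    and R: "R \<subseteq> N \<times> M" "rook R"
    and bound: "\<And>K q. K \<subseteq> R \<Longrightarrow> chain K \<Longrightarrow> q \<in> K \<Longrightarrow> (\<And>p. p \<in> K \<Longrightarrow> p = q \<or> below p q) \<Longrightarrow>
      card K \<le> card {i \<in> N - fst ` R. i \<le> fst q} \<and> card K \<le> card {j \<in> M - snd ` R. j \<le> snd q}"
  shows "\<exists>P. P \<subseteq> N \<times> M \<and> rook P \<and> fst ` P = N \<and> snd ` P = M \<and> shadow_set P = R"
proof -
  have finR: "finite R" using R(1) fin finite_subset by blast
  have injR: "inj_on fst R" "inj_on snd R" using R(2) unfolding rook_def by auto
  have RNM: "fst ` R \<subseteq> N" "snd ` R \<subseteq> M" using R(1) by auto
  define m where "m = card N - card R"
  have cardR: "card R \<le> card N" using injR(1) RNM(1) fin(1) by (rule card_inj_on_le)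
  have m: "card (N - fst ` R) = m" "card (M - snd ` R) = m"
    using RNM finR injR card by (auto simp: m_def card_Diff_subset card_image)
  define e where "e = sorted_list_of_set (N - fst ` R)"
  define f where "f = sorted_list_of_set (M - snd ` R)"
  have e: "set e = N - fst ` R" "sorted_wrt (<) e" "length e = m"
    and f: "set f = M - snd ` R" "sorted_wrt (<) f" "length f = m"
    unfolding e_def f_def using fin m by (auto simp: strict_sorted_iff)
  have e_less: "e ! a < e ! b" and f_less: "f ! a < f ! b" if "a < b" "b < m" for a b
    using that e f by (auto simp: sorted_wrt_nth_less)
  \<comment> \<open>Lists count from 0, so \<open>Suc k\<close> elements up to \<open>x\<close> put
    \<open>l ! k\<close> at most at \<open>x\<close>; strictness comes from \<open>x\<close> not
    being in \<open>A\<close>.\<close>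
  have nth_lt: "l ! k < x"
    if l: "sorted_wrt (<) l" "set l = A" "x \<notin> A" and k: "Suc k \<le> card {i \<in> A. i \<le> x}"
    for l :: "nat list" and A k x
  proof (rule ccontr)
    assume "\<not> l ! k < x"
    moreover have "card {i \<in> A. i \<le> x} \<le> card A" using l(2) by (intro card_mono) auto
    then have kl: "k < length l" using l k card_length[of l] by simp
    ultimately have "x < l ! k" using l nth_mem[OF kl] by (metis linorder_neqE_nat)
    have "{i \<in> A. i \<le> x} \<subseteq> (!) l ` {..<k}"
    proof
      fix i assume "i \<in> {i \<in> A. i \<le> x}"
      then obtain t where t: "t < length l" "l ! t = i" "i \<le> x" using l(2) by (auto simp: in_set_conv_nth)
      have "\<not> k \<le> t"
      proof
        assume "k \<le> t"
        then have "l ! k \<le> l ! t" using l(1) t(1) by (cases "k = t") (auto simp: sorted_wrt_nth_less less_imp_le)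
        then show False using t \<open>x < l ! k\<close> by simp
      qed
      then show "i \<in> (!) l ` {..<k}" using t by auto
    qed
    then have "card {i \<in> A. i \<le> x} \<le> card {..<k}" by (meson card_mono card_image_le finite_imageI finite_lessThan le_trans)
    then show False using k by simp
  qed
  \<comment> \<open>Label \<open>k\<close> is possible at \<open>q\<close> when line
    \<open>k\<close> enters in a row before that of \<open>q\<close> and leaves in a column before
    that of \<open>q\<close>.\<close>
  define ok where "ok = (\<lambda>q k. k < m \<and> e ! k < fst q \<and> f ! k < snd q)"
  define E where "E = (\<lambda>q. min (card {i \<in> N - fst ` R. i \<le> fst q}) (card {j \<in> M - snd ` R. j \<le> snd q}))"
  have "\<exists>h. (\<forall>p\<in>R. \<forall>q\<in>R. below p q \<longrightarrow> h p < h q) \<and> (\<forall>q\<in>R. h q < E q)"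
    using finR by (rule height_labelling) (use bound in \<open>auto simp: E_def\<close>)
  then obtain h0 where h0: "\<And>p q. p \<in> R \<Longrightarrow> q \<in> R \<Longrightarrow> below p q \<Longrightarrow> h0 p < h0 q" "\<And>q. q \<in> R \<Longrightarrow> h0 q < E q"
    by blast
  have ok0: "ok q (h0 q)" if "q \<in> R" for q
  proof -
    have le: "Suc (h0 q) \<le> card {i \<in> N - fst ` R. i \<le> fst q}" "Suc (h0 q) \<le> card {j \<in> M - snd ` R. j \<le> snd q}"
      using h0(2)[OF that] unfolding E_def by auto
    have "card {i \<in> N - fst ` R. i \<le> fst q} \<le> m" unfolding m(1)[symmetric] using fin by (intro card_mono) auto
    moreover have "e ! h0 q < fst q" using e that le by (intro nth_lt[of e "N - fst ` R"]) auto
    moreover have "f ! h0 q < snd q" using f that le by (intro nth_lt[of f "M - snd ` R"]) auto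
    ultimately show ?thesis unfolding ok_def using le by simp
  qed
  have "\<exists>h. (\<forall>p\<in>R. \<forall>q\<in>R. below p q \<longrightarrow> h p < h q) \<and> (\<forall>q\<in>R. ok q (h q)) \<and>
      (\<forall>q\<in>R. ok q (Suc (h q)) \<longrightarrow> (\<exists>q'\<in>R. below q q' \<and> h q' = Suc (h q)))"
    using finR h0(1) ok0 by (rule maximal_labelling) (auto simp: ok_def)
  then obtain h where mono: "\<And>p q. p \<in> R \<Longrightarrow> q \<in> R \<Longrightarrow> below p q \<Longrightarrow> h p < h q"
    and ok: "\<And>q. q \<in> R \<Longrightarrow> ok q (h q)"
    and max: "\<And>q. q \<in> R \<Longrightarrow> ok q (Suc (h q)) \<Longrightarrow> \<exists>q'\<in>R. below q q' \<and> h q' = Suc (h q)"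
    by blast
  \<comment> \<open>\<open>C a\<close> are the prescribed corners of line \<open>a\<close>. Maximality of \<open>h\<close> is what puts line \<open>a + 1\<close>
    strictly above line \<open>a\<close>: a point of line \<open>a + 1\<close> weakly below \<open>q \<in> C a\<close> would allow to raise \<open>h q\<close>.\<close>
  define C where "C = (\<lambda>a. {q \<in> R. h q = a})"
  have CR: "C a \<subseteq> R" for a unfolding C_def by auto
  have "\<forall>a. \<exists>ps. set ps = C a \<and> sorted_wrt (\<lambda>p q. fst p < fst q) ps"
  proof
    fix a
    have "finite (C a)" "inj_on fst (C a)" using CR finR injR by (auto intro: finite_subset inj_on_subset)
    then show "\<exists>ps. set ps = C a \<and> sorted_wrt (\<lambda>p q. fst p < fst q) ps" by (rule sorted_by_row)
  qed
  then obtain qs where qs: "\<And>a. set (qs a) = C a" "\<And>a. sorted_wrt (\<lambda>p q. fst p < fst q) (qs a)"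
    by metis
  \<comment> \<open>Points with equal labels are incomparable under \<open>below\<close>, so
    increasing rows force decreasing columns.\<close>
  have qs_desc: "sorted_wrt (\<lambda>p q. snd q < snd p) (qs a)" for a
  proof (rule sorted_wrt_mono_rel[OF _ qs(2)])
    fix p q assume pq: "p \<in> set (qs a)" "q \<in> set (qs a)" "fst p < fst q"
    then have "p \<in> R" "q \<in> R" "h p = a" "h q = a" unfolding qs C_def by auto
    then have "\<not> below p q" using mono[of p q] by auto
    moreover have "snd p \<noteq> snd q" using injR(2) \<open>p \<in> R\<close> \<open>q \<in> R\<close> pq(3) by (auto dest: inj_onD)
    ultimately show "snd q < snd p" using pq(3) unfolding below_def by simp
  qed
  \<comment> \<open>Line \<open>a\<close> has one point more than corners. Prepending the entry row
    and appending the exit column shifts the lists against each other, so that the corner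
    \<open>(xs a ! Suc t, ys a ! t)\<close> is \<open>qs a ! t\<close>.\<close>
  define xs where "xs = (\<lambda>a. e ! a # map fst (qs a))"
  define ys where "ys = (\<lambda>a. map snd (qs a) @ [f ! a])"
  define L where "L = (\<lambda>a. set (zip (xs a) (ys a)))"
  define P where "P = (\<Union>a<m. L a)"
  have len: "length (ys a) = length (xs a)" for a by (simp add: xs_def ys_def)
  have set_xs: "set (xs a) = insert (e ! a) (fst ` C a)" and set_ys: "set (ys a) = insert (f ! a) (snd ` C a)" for a
    by (auto simp: xs_def ys_def qs(1)[symmetric])
  have C_gt: "e ! a < fst q" "f ! a < snd q" if "q \<in> C a" for q a
    using that ok[of q] unfolding C_def ok_def by simp_all
  have xs_sorted: "sorted_wrt (<) (xs a)" for a
    unfolding xs_def using qs(2)[of a] C_gt qs(1)[of a] by (auto simp: sorted_wrt_map)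
  have ys_sorted: "sorted_wrt (>) (ys a)" for a
    unfolding ys_def using qs_desc[of a] C_gt qs(1)[of a] by (auto simp: sorted_wrt_append sorted_wrt_map)
  have L_nth: "\<exists>t < length (xs a). p = (xs a ! t, ys a ! t)" if "p \<in> L a" for p a
    using that len unfolding L_def by (auto simp: set_zip)
  have C_nth: "\<exists>t. Suc t < length (xs a) \<and> q = (xs a ! Suc t, ys a ! t)" if q: "q \<in> C a" for q a
  proof -
    obtain t where t: "t < length (qs a)" "qs a ! t = q" using q qs(1)[of a] by (metis in_set_conv_nth)
    then have "xs a ! Suc t = fst q" "ys a ! t = snd q" "Suc t < length (xs a)"
      by (auto simp: xs_def ys_def nth_append)
    then show ?thesis by (metis prod.collapse)
  qed
  have corners_L: "corners (L a) = C a" for a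
  proof -
    have "corners (L a) = {(xs a ! Suc t, ys a ! t) | t. Suc t < length (xs a)}"
      unfolding L_def by (rule corners_zip[OF len xs_sorted])
    also have "\<dots> = {(fst (qs a ! t), snd (qs a ! t)) | t. t < length (qs a)}"
      by (intro Collect_cong ex_cong1) (auto simp: xs_def ys_def nth_append)
    also have "\<dots> = C a" unfolding qs(1)[symmetric] set_conv_nth by simp
    finally show ?thesis .
  qed
  \<comment> \<open>Relative to the corner with index \<open>u\<close>, points of the line up to
    index \<open>u\<close> have columns no smaller, and later points have rows no smaller.\<close>
  have no_corner_above: "\<not> below p q" if p: "p \<in> L a" and q: "q \<in> C a" for p q a
  proof
    assume pq: "below p q"
    obtain t where t: "t < length (xs a)" "p = (xs a ! t, ys a ! t)" using L_nth[OF p] by blast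
    obtain u where u: "Suc u < length (xs a)" "q = (xs a ! Suc u, ys a ! u)" using C_nth[OF q] by blast
    have "xs a ! t < xs a ! Suc u" "ys a ! t < ys a ! u" using pq t u unfolding below_def by auto
    show False
    proof (cases "Suc u \<le> t")
      case True
      then have "xs a ! Suc u \<le> xs a ! t"
        using xs_sorted[of a] t(1) by (cases "Suc u = t") (auto simp: sorted_wrt_nth_less less_imp_le)
      then show False using \<open>xs a ! t < _\<close> by simp
    next
      case False
      then have "ys a ! u \<le> ys a ! t"
        using sorted_wrt_nth_less[OF ys_sorted[of a], of t u] u(1) len[of a] by (cases "t = u") auto
      then show False using \<open>ys a ! t < _\<close> by simp
    qed
  qed
  have "shadow_set P = (\<Union>a<m. corners (L a))"
    unfolding P_def
  proof (rule shadow_set_levels)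
    fix a p q assume pq: "p \<in> L a" "q \<in> L a"
    show "\<not> below p q"
    proof
      assume b: "below p q"
      obtain t where t: "t < length (xs a)" "p = (xs a ! t, ys a ! t)" using L_nth[OF pq(1)] by blast
      obtain u where u: "u < length (xs a)" "q = (xs a ! u, ys a ! u)" using L_nth[OF pq(2)] by blast
      have "xs a ! t < xs a ! u" "ys a ! t < ys a ! u" using b t u unfolding below_def by auto
      then show False
        using sorted_wrt_nth_less[OF xs_sorted[of a], of u t] sorted_wrt_nth_less[OF ys_sorted[of a], of t u]
          t(1) u(1) len[of a]
        by (cases t u rule: linorder_cases) auto
    qed
  next
    fix a p assume a: "Suc a < m" and p: "p \<in> L (Suc a)"
    have fst_p: "fst p \<in> set (xs (Suc a))" and snd_p: "snd p \<in> set (ys (Suc a))"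
      using p unfolding L_def by (metis prod.collapse set_zip_leftD, metis prod.collapse set_zip_rightD)
    have e_le: "e ! Suc a \<le> fst p" using fst_p C_gt(1) unfolding set_xs by (auto simp: less_imp_le)
    have f_le: "f ! Suc a \<le> snd p" using snd_p C_gt(2) unfolding set_ys by (auto simp: less_imp_le)
    have "\<exists>q\<in>set (zip (xs a) (ys a)). below q (fst p, snd p)"
    proof (rule zip_dominates[OF len])
      show "xs a \<noteq> []" by (simp add: xs_def)
      show "xs a ! 0 < fst p" using e_less[of a "Suc a"] a e_le by (simp add: xs_def)
      show "last (ys a) < snd p" using f_less[of a "Suc a"] a f_le by (simp add: ys_def)
      fix t assume t: "Suc t < length (xs a)" and le: "fst p \<le> xs a ! Suc t"
      have "qs a ! t \<in> C a" using t nth_mem[of t "qs a"] unfolding qs(1) by (simp add: xs_def)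
      moreover define q where "q = qs a ! t"
      ultimately have q: "q \<in> R" "h q = a" unfolding C_def by auto
      have q_xy: "fst q = xs a ! Suc t" "snd q = ys a ! t"
        using t by (auto simp: q_def xs_def ys_def nth_append)
      show "ys a ! t < snd p"
      proof (rule ccontr)
        assume "\<not> ?thesis"
        then have "snd p \<le> snd q" "fst p \<le> fst q" using le q_xy by auto
        \<comment> \<open>Points of \<open>R\<close> avoid the free rows and columns, so the bounds
          of \<open>e ! Suc a\<close> and \<open>f ! Suc a\<close> by the coordinates of
          \<open>q\<close> are strict and label \<open>Suc a\<close> is possible at
          \<open>q\<close>. Maximality then yields a corner of the next line with \<open>p\<close>
          below it.\<close>
        have "e ! Suc a \<in> set e" "f ! Suc a \<in> set f"
          using nth_mem[of "Suc a" e] nth_mem[of "Suc a" f] a e(3) f(3) by simp_all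
        then have "e ! Suc a \<noteq> fst q" "f ! Suc a \<noteq> snd q"
          unfolding e(1) f(1) using q(1) by auto
        then have "ok q (Suc (h q))" unfolding ok_def q(2)
          using a e_le f_le \<open>snd p \<le> snd q\<close> \<open>fst p \<le> fst q\<close> by auto
        then obtain q' where q': "q' \<in> R" "below q q'" "h q' = Suc a" using max[OF q(1)] q(2) by auto
        then have "below p q'" using \<open>snd p \<le> snd q\<close> \<open>fst p \<le> fst q\<close> unfolding below_def by auto
        moreover have "q' \<in> C (Suc a)" using q' unfolding C_def by simp
        ultimately show False using no_corner_above[OF p] by blast
      qed
    qed
    then show "\<exists>q\<in>L a. below q p" unfolding L_def by simp
  qed
  moreover have C_Un: "(\<Union>a<m. C a) = R" using ok unfolding C_def ok_def by auto
  ultimately have shadow: "shadow_set P = R" by (simp add: corners_L)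
  have eN: "(\<Union>a<m. {e ! a}) = N - fst ` R" and fM: "(\<Union>a<m. {f ! a}) = M - snd ` R"
    using e f by (auto simp: set_conv_nth[of e, unfolded e(1)] set_conv_nth[of f, unfolded f(1)])
  have fst_L: "fst ` L a = set (xs a)" and snd_L: "snd ` L a = set (ys a)" for a
    unfolding L_def by (metis len list.set_map map_fst_zip, metis len list.set_map map_snd_zip)
  have fst_P: "fst ` P = N"
  proof -
    have "fst ` P = (\<Union>a<m. {e ! a}) \<union> fst ` (\<Union>a<m. C a)"
      unfolding P_def image_UN fst_L set_xs by auto
    then show ?thesis unfolding eN C_Un using RNM by auto
  qed
  have snd_P: "snd ` P = M"
  proof -
    have "snd ` P = (\<Union>a<m. {f ! a}) \<union> snd ` (\<Union>a<m. C a)"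
      unfolding P_def image_UN snd_L set_ys by auto
    then show ?thesis unfolding fM C_Un using RNM by auto
  qed
  have finP: "finite P" unfolding P_def L_def by simp
  \<comment> \<open>Each line has at most one point more than it has corners, so \<open>P\<close>
    has at most \<open>m + card R\<close>, that is \<open>card N\<close>, points. As it projects
    onto \<open>N\<close> and \<open>M\<close>, both projections are injective.\<close>
  have "card P \<le> (\<Sum>a<m. card (L a))" unfolding P_def by (intro card_UN_le) simp
  also have "\<dots> \<le> (\<Sum>a<m. Suc (card (C a)))"
  proof (rule sum_mono)
    fix a
    have "sorted_wrt (<) (map fst (qs a))" using qs(2)[of a] by (simp add: sorted_wrt_map)
    then have "distinct (qs a)" by (auto simp: strict_sorted_iff distinct_map)
    then have "length (qs a) = card (C a)" using qs(1)[of a] distinct_card by metis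
    moreover have "card (L a) \<le> length (zip (xs a) (ys a))" unfolding L_def by (rule card_length)
    ultimately show "card (L a) \<le> Suc (card (C a))" by (simp add: xs_def ys_def)
  qed
  also have "\<dots> = (\<Sum>a<m. card (C a)) + m" by (simp add: sum_Suc)
  also have "(\<Sum>a<m. card (C a)) = card (\<Union>a<m. C a)"
    using finR CR by (intro card_UN_disjoint[symmetric]) (auto simp: C_def intro: finite_subset)
  also have "\<dots> + m = card N" unfolding C_Un using cardR by (simp add: m_def)
  finally have "card P \<le> card N" .
  moreover have "card (fst ` P) \<le> card P" "card (snd ` P) \<le> card P" using finP by (auto intro: card_image_le)
  ultimately have "card (fst ` P) = card P" "card (snd ` P) = card P" using fst_P snd_P card by auto
  then have "rook P" unfolding rook_def using finP by (auto intro: eq_card_imp_inj_on)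
  moreover have "P \<subseteq> N \<times> M" using fst_P snd_P by (metis subset_fst_snd)
  ultimately show ?thesis using fst_P snd_P shadow by blast
qed

section \<open>Monomials modulo the ideal\<close>

lemma rook_swap: "rook (prod.swap ` R) \<longleftrightarrow> rook R"
  by (simp add: rook_def inj_on_def inj_eq[OF inj_swap] conj_commute)

lemma chain_swap: "chain (prod.swap ` K) \<longleftrightarrow> chain K"
  by (simp add: chain_def below_def inj_eq[OF inj_swap] conj_commute)

lemma precedes_swap:
  assumes "precedes (prod.swap ` R) R'" shows "precedes R (prod.swap ` R')"
proof -
  obtain q where q: "q \<in> prod.swap ` R - R'"
    and min: "\<And>q'. q' \<in> R' - prod.swap ` R \<Longrightarrow> fst q \<le> fst q' \<and> snd q \<le> snd q'"
    using assms unfolding precedes_def by blast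
  have "prod.swap q \<in> R - prod.swap ` R'" using q by auto
  moreover have "fst (prod.swap q) \<le> fst q' \<and> snd (prod.swap q) \<le> snd q'"
    if "q' \<in> prod.swap ` R' - R" for q'
  proof -
    have "prod.swap q' \<in> R' - prod.swap ` R" using that by auto
    then show ?thesis using min[of "prod.swap q'"] by simp
  qed
  ultimately show ?thesis unfolding precedes_def by blast
qed

text \<open>
  The base exceeds the number of cells, so a single cell outweighs any set of cells with larger
  coordinate sum.
\<close>

definition weight :: "nat \<Rightarrow> (nat \<times> nat) set \<Rightarrow> nat" where
  "weight n R = (\<Sum>p\<in>R. Suc (n * n) ^ (2 * n - (fst p + snd p)))"

text \<open>Cells common to \<open>R\<close> and \<open>R'\<close> cancel. The cell \<open>q\<close>
  given by \<open>precedes\<close> alone outweighs \<open>R' - R\<close>, whose cells all have a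
  larger coordinate sum.\<close>

lemma precedes_weight:
  assumes R: "R \<subseteq> {1..n} \<times> {1..n}" and R': "R' \<subseteq> {1..n} \<times> {1..n}" and "precedes R R'"
  shows "weight n R' < weight n R"
proof -
  define g where "g = (\<lambda>p. Suc (n * n) ^ (2 * n - (fst p + snd p)))"
  obtain q where q: "q \<in> R - R'" and min: "\<And>q'. q' \<in> R' - R \<Longrightarrow> fst q \<le> fst q' \<and> snd q \<le> snd q'"
    using assms(3) unfolding precedes_def by blast
  have fin: "finite R" "finite R'" using R R' by (auto intro: finite_subset)
  have "g q' * Suc (n * n) \<le> g q" if q': "q' \<in> R' - R" for q'
  proof -
    have "q' \<noteq> q" using q q' by auto
    then have "fst q + snd q < fst q' + snd q'" using min[OF q'] by (auto simp: prod_eq_iff)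
    \<comment> \<open>The coordinate sums stay within \<open>2 * n\<close>, so the natural-number
      subtraction in the exponent does not truncate.\<close>
    moreover have "fst q' + snd q' \<le> 2 * n" using R' q' by fastforce
    ultimately have "Suc (2 * n - (fst q' + snd q')) \<le> 2 * n - (fst q + snd q)" by simp
    then have "Suc (n * n) ^ Suc (2 * n - (fst q' + snd q')) \<le> g q"
      unfolding g_def by (rule power_increasing) simp
    then show ?thesis unfolding g_def by (simp only: power_Suc mult.commute)
  qed
  then have "(\<Sum>p\<in>R' - R. g p * Suc (n * n)) \<le> of_nat (card (R' - R)) * g q"
    by (rule sum_bounded_above)
  moreover have "card (R' - R) \<le> card ({1..n} \<times> {1..n})" using R' by (intro card_mono) auto
  ultimately have "sum g (R' - R) * Suc (n * n) \<le> (n * n) * g q"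
    unfolding sum_distrib_right by (force intro: order_trans mult_le_mono1)
  also have "\<dots> < g q * Suc (n * n)" unfolding g_def by simp
  finally have "sum g (R' - R) < g q" using mult_less_cancel2 by blast
  also have "g q \<le> sum g (R - R')" using q fin by (intro member_le_sum) auto
  finally have "sum g (R' - R) + sum g (R' \<inter> R) < sum g (R - R') + sum g (R \<inter> R')"
    by (simp add: Int_commute)
  moreover have "sum g R' = sum g (R' - R) + sum g (R' \<inter> R)" "sum g R = sum g (R - R') + sum g (R \<inter> R')"
    using fin by (metis add.commute sum.Int_Diff)+
  ultimately show ?thesis unfolding weight_def g_def[symmetric] by simp
qed

section \<open>Monomials as products of powers of variables\<close>

lemma poly_mapping_expansion: "a = (\<Sum>p\<in>Poly_Mapping.keys a. Poly_Mapping.single p (Poly_Mapping.lookup a p))"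
proof (rule poly_mapping_eqI)
  fix k
  have "Poly_Mapping.lookup (\<Sum>p\<in>Poly_Mapping.keys a. Poly_Mapping.single p (Poly_Mapping.lookup a p)) k =
      (\<Sum>p\<in>Poly_Mapping.keys a. if p = k then Poly_Mapping.lookup a p else 0)"
    by (simp add: lookup_sum lookup_single when_def)
  also have "\<dots> = Poly_Mapping.lookup a k" by (simp add: in_keys_iff)
  finally show "Poly_Mapping.lookup a k =
      Poly_Mapping.lookup (\<Sum>p\<in>Poly_Mapping.keys a. Poly_Mapping.single p (Poly_Mapping.lookup a p)) k" by simp
qed

lemma var_power: "var p ^ k = Poly_Mapping.single (Poly_Mapping.single p k) 1"
  by (induction k) (auto simp: var_def mult_single single_add[symmetric] single_one)

lemma prod_single_one:
  "(\<Prod>x\<in>A. Poly_Mapping.single (g x) (1 :: complex)) = Poly_Mapping.single (\<Sum>x\<in>A. g x) 1"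
  for g :: "'b \<Rightarrow> (nat \<times> nat) \<Rightarrow>\<^sub>0 nat"
  by (induction A rule: infinite_finite_induct) (auto simp: mult_single)

lemma single_one_eq_prod:
  "Poly_Mapping.single a (1 :: complex) = (\<Prod>p\<in>Poly_Mapping.keys a. var p ^ Poly_Mapping.lookup a p)"
proof -
  have "(\<Prod>p\<in>Poly_Mapping.keys a. var p ^ Poly_Mapping.lookup a p) =
      Poly_Mapping.single (\<Sum>p\<in>Poly_Mapping.keys a. Poly_Mapping.single p (Poly_Mapping.lookup a p)) 1"
    unfolding var_power by (rule prod_single_one)
  then show ?thesis by (simp only: poly_mapping_expansion[of a, symmetric])
qed

lemma cpoly_expansion:
  "f = (\<Sum>a\<in>Poly_Mapping.keys f. const_poly (Poly_Mapping.lookup f a) * Poly_Mapping.single a 1)"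
  for f :: cpoly
  unfolding const_poly_def mult_single add_0_left mult_1_right by (rule poly_mapping_expansion)

text \<open>A rook placement meeting every row and column is the graph of a permutation. Since
  \<open>color_class\<close> evaluates the coloring at the image of \<open>i\<close>, the color of a
  cell is attached to its column.\<close>

lemma colored_perm_of_rook:
  assumes T: "T \<subseteq> {1..n} \<times> {1..n}" "rook T" "fst ` T = {1..n}" "snd ` T = {1..n}"
    and c: "\<And>p. p \<in> T \<Longrightarrow> c p < r"
  shows "\<exists>w\<in>colored_perms n r. \<forall>l. color_class n w l = {p \<in> T. c p = l}"
proof -
  have inj: "inj_on fst T" "inj_on snd T" using T(2) unfolding rook_def by auto
  \<comment> \<open>Outside \<open>{1..n}\<close> this is the identity, as \<open>permutes\<close>
    demands, while the coloring is \<open>undefined\<close> there, as the extensional function space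
    demands.\<close>
  define \<sigma> where "\<sigma> = (\<lambda>i. if i \<in> {1..n} then snd (the_inv_into T fst i) else i)"
  define \<kappa> where "\<kappa> = (\<lambda>j\<in>{1..n}. c (the_inv_into T snd j))"
  have \<sigma>: "\<sigma> (fst p) = snd p" and \<kappa>: "\<kappa> (snd p) = c p" if "p \<in> T" for p
    using that T(1) the_inv_into_f_f[OF inj(1) that] the_inv_into_f_f[OF inj(2) that]
    unfolding \<sigma>_def \<kappa>_def by (auto simp: mem_Times_iff)
  have "inj_on \<sigma> {1..n}"
  proof (rule inj_onI)
    fix i i' assume "i \<in> {1..n}" "i' \<in> {1..n}" and eq: "\<sigma> i = \<sigma> i'"
    then obtain p p' where p: "p \<in> T" "i = fst p" "p' \<in> T" "i' = fst p'" using T(3) by (metis imageE)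
    then have "snd p = snd p'" using eq \<sigma> by simp
    then show "i = i'" using p inj(2) by (metis inj_onD)
  qed
  moreover have "\<sigma> ` {1..n} = {1..n}"
  proof -
    have "\<sigma> ` fst ` T = snd ` T" unfolding image_image by (intro image_cong) (auto simp: \<sigma>)
    then show ?thesis unfolding T(3,4) .
  qed
  ultimately have "\<sigma> permutes {1..n}"
    by (intro bij_imp_permutes) (auto simp: bij_betw_def \<sigma>_def)
  moreover have "\<kappa> \<in> {1..n} \<rightarrow>\<^sub>E {0..<r}"
  proof (rule PiE_I)
    fix j assume "j \<in> {1..n}"
    then obtain p where "p \<in> T" "j = snd p" using T(4) by (metis imageE)
    then show "\<kappa> j \<in> {0..<r}" using \<kappa> c by simp
  qed (auto simp: \<kappa>_def)
  moreover have "color_class n (\<sigma>, \<kappa>) l = {p \<in> T. c p = l}" for l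
  proof -
    have "color_class n (\<sigma>, \<kappa>) l = {(i, \<sigma> i) | i. i \<in> fst ` T \<and> \<kappa> (\<sigma> i) = l}"
      unfolding color_class_def T(3) by simp
    also have "\<dots> = {p \<in> T. c p = l}"
      using \<sigma> \<kappa> by (auto simp: image_iff) (metis fst_conv snd_conv)+
    finally show ?thesis .
  qed
  ultimately show ?thesis unfolding colored_perms_def by blast
qed

lemma subring_ideal_colored: "subring_ideal (carrier (poly_ring n)) (colored_ideal n r)"
proof -
  interpret I: ideal "colored_ideal n r" "poly_ring n" by (rule colored_ideal_ideal)
  show ?thesis
    using additive_subgroup.a_closed[OF I.is_additive_subgroup]
      additive_subgroup.zero_closed[OF I.is_additive_subgroup] I.I_l_closed
    by unfold_locales (auto intro: poly_ring_1 poly_ring_add poly_ring_uminus poly_ring_mult)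
qed

section \<open>Relations modulo the ideal and spanning by shadow monomials\<close>

context
  fixes n r :: nat
begin

interpretation subring_ideal "carrier (poly_ring n)" "colored_ideal n r"
  by (rule subring_ideal_colored)

lemma gens_in_ideal: "gens n r \<subseteq> colored_ideal n r"
  unfolding colored_ideal_def
  by (rule ring.genideal_self[OF cring.axioms(1)[OF poly_ring_cring] gens_subset])

lemma var_same_row:
  assumes "i \<in> {1..n}" "j \<in> {1..n}" "j' \<in> {1..n}" "j \<noteq> j'"
  shows "var (i, j) * var (i, j') \<in> colored_ideal n r"
proof -
  have gen: "var (i, k) * var (i, k') \<in> colored_ideal n r" if "k \<in> {1..n}" "k' \<in> {1..n}" "k < k'" for k k'
  proof (rule subsetD[OF gens_in_ideal])
    show "var (i, k) * var (i, k') \<in> gens n r" unfolding gens_def using assms(1) that by blast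
  qed
  show ?thesis using gen[of j j'] gen[of j' j] assms by (cases j j' rule: linorder_cases) (auto simp: mult.commute)
qed

lemma var_same_col:
  assumes "i \<in> {1..n}" "i' \<in> {1..n}" "j \<in> {1..n}" "i \<noteq> i'"
  shows "var (i, j) * var (i', j) \<in> colored_ideal n r"
proof -
  have gen: "var (k, j) * var (k', j) \<in> colored_ideal n r" if "k \<in> {1..n}" "k' \<in> {1..n}" "k < k'" for k k'
  proof (rule subsetD[OF gens_in_ideal])
    show "var (k, j) * var (k', j) \<in> gens n r" unfolding gens_def using assms(3) that by blast
  qed
  show ?thesis using gen[of i i'] gen[of i' i] assms by (cases i i' rule: linorder_cases) (auto simp: mult.commute)
qed

lemma row_sum: "i \<in> {1..n} \<Longrightarrow> (\<Sum>j\<in>{1..n}. var (i, j) ^ r) \<in> colored_ideal n r"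
  by (rule subsetD[OF gens_in_ideal], unfold gens_def, rule UnI1, rule UnI2) blast

lemma col_sum: "j \<in> {1..n} \<Longrightarrow> (\<Sum>i\<in>{1..n}. var (i, j) ^ r) \<in> colored_ideal n r"
  by (rule subsetD[OF gens_in_ideal], unfold gens_def, rule UnI2) blast

lemma var_high_power:
  assumes "p \<in> {1..n} \<times> {1..n}" "r < k" shows "var p ^ k \<in> colored_ideal n r"
proof -
  have "var (fst p, snd p) ^ (r + 1) \<in> gens n r"
    unfolding gens_def using assms(1) mem_Times_iff by blast
  then have "var p ^ (r + 1) \<in> colored_ideal n r" using gens_in_ideal by auto
  then have "var p ^ (k - (r + 1)) * var p ^ (r + 1) \<in> colored_ideal n r"
    by (intro mult_I power_C var_in_poly_ring assms)
  moreover have "k - (r + 1) + (r + 1) = k" using assms(2) by simp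
  ultimately show ?thesis by (metis power_add)
qed

lemma attacking_powers:
  assumes "p \<in> {1..n} \<times> {1..n}" "q \<in> {1..n} \<times> {1..n}" "p \<noteq> q" "fst p = fst q \<or> snd p = snd q"
    and "0 < k" "0 < l"
  shows "var p ^ k * var q ^ l \<in> colored_ideal n r"
proof -
  have pq: "var p * var q \<in> colored_ideal n r"
    using assms var_same_row[of "fst p" "snd p" "snd q"] var_same_col[of "fst p" "fst q" "snd p"]
    by (cases p; cases q) auto
  have "(var p ^ (k - 1) * var q ^ (l - 1)) * (var p * var q) \<in> colored_ideal n r"
    by (intro mult_I[OF mult_C pq] power_C var_in_poly_ring assms)
  moreover have "(var p ^ (k - 1) * var q ^ (l - 1)) * (var p * var q) =
      var p ^ Suc (k - 1) * var q ^ Suc (l - 1)"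
    by (simp add: mult_ac)
  ultimately show ?thesis using assms(5,6) by simp
qed

text \<open>\<open>W\<close> abstracts the preimage of the span in the polynomial ring. By induction
  on \<open>weight\<close>, a chain that is too long allows straightening to placements of smaller
  weight; otherwise \<open>R\<close> is a shadow set and the monomial is itself a shadow
  monomial.\<close>

lemma monomials_spanned:
  assumes W: "colored_ideal n r \<subseteq> W" "\<And>f g. f \<in> W \<Longrightarrow> g \<in> W \<Longrightarrow> f + g \<in> W" "\<And>f. f \<in> W \<Longrightarrow> - f \<in> W"
    and gen: "\<And>w. w \<in> colored_perms n r \<Longrightarrow> shadow_monomial n r w \<in> W"
    and Q: "Q \<subseteq> {1..n} \<times> {1..n}" "rook Q" and c: "\<And>p. p \<in> Q \<Longrightarrow> 0 < c p \<and> c p < r"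
    and r: "0 < r"
    and R: "R \<subseteq> ({1..n} - fst ` Q) \<times> ({1..n} - snd ` Q)" "rook R"
  shows "(\<Prod>p\<in>R. var p ^ r) * (\<Prod>p\<in>Q. var p ^ c p) \<in> W"
  using R
proof (induction R rule: measure_induct_rule[where f = "weight n"])
  case (less R)
  define N where "N = {1..n} - fst ` Q"
  define M where "M = {1..n} - snd ` Q"
  define m where "m = (\<Prod>p\<in>Q. var p ^ c p)"
  define z where "z = (\<lambda>p. var p ^ r)"
  have NM: "N \<subseteq> {1..n}" "M \<subseteq> {1..n}" "finite N" "finite M" unfolding N_def M_def by auto
  have R: "R \<subseteq> N \<times> M" "rook R" using less.prems unfolding N_def M_def by auto
  have finQ: "finite Q" using Q(1) by (rule finite_subset) simp
  have IH: "prod z R' * m \<in> W" if "R' \<subseteq> N \<times> M" "rook R'" "precedes R R'" for R'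
  proof -
    have "R \<subseteq> {1..n} \<times> {1..n}" "R' \<subseteq> {1..n} \<times> {1..n}" using R that NM by auto
    then have "weight n R' < weight n R" using that(3) by (rule precedes_weight)
    then show ?thesis using less.IH that unfolding N_def M_def z_def m_def by blast
  qed
  have zC: "z p \<in> carrier (poly_ring n)" if "p \<in> {1..n} \<times> {1..n}" for p
    using that unfolding z_def by (intro power_C var_in_poly_ring)
  have cC: "var p ^ c p \<in> carrier (poly_ring n)" if "p \<in> Q" for p
    using that Q(1) by (intro power_C var_in_poly_ring) auto
  have mC: "m \<in> carrier (poly_ring n)" unfolding m_def using cC by (rule prod_C)
  have kill: "z p * m \<in> colored_ideal n r"
    if p: "p \<in> {1..n} \<times> {1..n}" and q: "q \<in> Q" "fst p = fst q \<or> snd p = snd q" for p q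
  proof -
    \<comment> \<open>At the cell \<open>q\<close> itself the exponents add up to more than
      \<open>r\<close> because \<open>c q\<close> is positive; any other cell in the row or column
      of \<open>q\<close> attacks it.\<close>
    have "z p * var q ^ c q \<in> colored_ideal n r"
    proof (cases "p = q")
      case True
      then show ?thesis using var_high_power[OF p, of "r + c q"] c[OF q(1)] by (simp add: z_def power_add)
    next
      case False
      then show ?thesis unfolding z_def using p q Q(1) r c[OF q(1)] by (intro attacking_powers) auto
    qed
    then have "(\<Prod>p\<in>Q. var p ^ c p) * z p \<in> colored_ideal n r"
      using q(1) finQ cC by (intro prod_I[of _ q]) (auto simp: mult.commute)
    then show ?thesis unfolding m_def by (simp add: mult.commute)
  qed
  have goal: "(\<Prod>p\<in>R. var p ^ r) * (\<Prod>p\<in>Q. var p ^ c p) = prod z R * m"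
    unfolding z_def m_def by simp
  consider
      (cols) K q where "K \<subseteq> R" "chain K" "q \<in> K" "\<And>p. p \<in> K \<Longrightarrow> p = q \<or> below p q"
        "card {j \<in> M - snd ` R. j \<le> snd q} < card K"
    | (rows) K q where "K \<subseteq> R" "chain K" "q \<in> K" "\<And>p. p \<in> K \<Longrightarrow> p = q \<or> below p q"
        "card {i \<in> N - fst ` R. i \<le> fst q} < card K"
    | (ballot) "\<And>K q. K \<subseteq> R \<Longrightarrow> chain K \<Longrightarrow> q \<in> K \<Longrightarrow> (\<And>p. p \<in> K \<Longrightarrow> p = q \<or> below p q) \<Longrightarrow>
        card K \<le> card {i \<in> N - fst ` R. i \<le> fst q} \<and> card K \<le> card {j \<in> M - snd ` R. j \<le> snd q}"
    by (meson not_le)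
  then have "prod z R * m \<in> W"
  proof cases
    case cols
    have y: "snd p \<le> snd q" if "p \<in> K" for p using cols(4)[OF that] unfolding below_def by auto
    show ?thesis
    proof (rule straighten[OF _ NM(1,2) R zC _ _ mC _ cols(1,2) y cols(5) W IH])
      show "(\<Sum>j\<in>{1..n}. z (i, j)) \<in> colored_ideal n r" if "i \<in> {1..n}" for i
        unfolding z_def using that by (rule row_sum)
      show "z (i, j) * z (i', j) \<in> colored_ideal n r"
        if "i \<in> {1..n}" "i' \<in> {1..n}" "j \<in> {1..n}" "i \<noteq> i'" for i i' j
        unfolding z_def using that r by (intro attacking_powers) auto
      show "z (i, j) * m \<in> colored_ideal n r" if ij: "i \<in> {1..n}" "j \<in> {1..n} - M" for i j
      proof -
        obtain q where "q \<in> Q" "snd q = j" using ij unfolding M_def by auto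
        then show ?thesis using kill[of "(i, j)" q] ij by auto
      qed
    qed auto
  next
    case rows
    have y: "snd p \<le> fst q" if "p \<in> prod.swap ` K" for p
      using rows(4)[of "prod.swap p"] that unfolding below_def by auto
    have swap_prod: "prod (\<lambda>p. z (prod.swap p)) (prod.swap ` R') = prod z R'" for R'
      by (subst prod.reindex) auto
    \<comment> \<open>Transposition exchanges \<open>N\<close> with \<open>M\<close> and row sums
      with column sums; the chain is then bounded by the row of \<open>q\<close>.\<close>
    have "prod (\<lambda>p. z (prod.swap p)) (prod.swap ` R) * m \<in> W"
    proof (rule straighten[OF _ NM(2,1) _ _ _ _ _ mC _ _ _ y _ W])
      show "prod.swap ` R \<subseteq> M \<times> N" using R(1) by auto
      show "rook (prod.swap ` R)" "chain (prod.swap ` K)" using R(2) rows(2) by (auto simp: rook_swap chain_swap)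
      show "prod.swap ` K \<subseteq> prod.swap ` R" using rows(1) by (rule image_mono)
      show "z (prod.swap p) \<in> carrier (poly_ring n)" if "p \<in> {1..n} \<times> {1..n}" for p
        using that by (intro zC) auto
      show "(\<Sum>j\<in>{1..n}. z (prod.swap (i, j))) \<in> colored_ideal n r" if "i \<in> {1..n}" for i
        using that col_sum unfolding z_def by simp
      show "z (prod.swap (i, j)) * z (prod.swap (i', j)) \<in> colored_ideal n r"
        if "i \<in> {1..n}" "i' \<in> {1..n}" "j \<in> {1..n}" "i \<noteq> i'" for i i' j
        unfolding z_def using that r by (intro attacking_powers) auto
      show "z (prod.swap (i, j)) * m \<in> colored_ideal n r" if ij: "i \<in> {1..n}" "j \<in> {1..n} - N" for i j
      proof -
        obtain q where "q \<in> Q" "fst q = j" using ij unfolding N_def by auto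
        then show ?thesis using kill[of "(j, i)" q] ij by auto
      qed
      have "snd ` prod.swap ` R = fst ` R" by (force simp: image_image)
      moreover have "card (prod.swap ` K) = card K" by (rule card_image) simp
      ultimately show "card {j \<in> N - snd ` prod.swap ` R. j \<le> fst q} < card (prod.swap ` K)"
        using rows(5) by simp
      fix R' assume R': "R' \<subseteq> M \<times> N" "rook R'" "precedes (prod.swap ` R) R'"
      have "prod z (prod.swap ` R') * m \<in> W"
        using R' by (intro IH) (auto simp: rook_swap precedes_swap)
      then show "prod (\<lambda>p. z (prod.swap p)) R' * m \<in> W"
        by (subst (asm) prod.reindex) auto
    qed auto
    then show ?thesis unfolding swap_prod .
  next
    case ballot
    have "card N = card M"
      using Q finQ unfolding N_def M_def rook_def
      by (subst (1 2) card_Diff_subset) (auto simp: card_image)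
    then obtain P where P: "P \<subseteq> N \<times> M" "rook P" "fst ` P = N" "snd ` P = M" "shadow_set P = R"
      using shadow_preimage[OF NM(3,4) _ R ballot] by blast
    have disj: "fst ` P \<inter> fst ` Q = {}" "snd ` P \<inter> snd ` Q = {}" unfolding P N_def M_def by auto
    have PQ: "P \<inter> Q = {}" using disj by auto
    have Qfst: "fst ` Q \<subseteq> {1..n}" "snd ` Q \<subseteq> {1..n}" using Q(1) by auto
    \<comment> \<open>Cells of \<open>P\<close> receive color 0, so that their shadow set
      \<open>R\<close> contributes the \<open>r\<close>-th powers; a cell of \<open>Q\<close>
      receives its exponent as color.\<close>
    have "\<exists>w\<in>colored_perms n r. \<forall>l. color_class n w l = {p \<in> P \<union> Q. (if p \<in> Q then c p else 0) = l}"
    proof (rule colored_perm_of_rook)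
      show "P \<union> Q \<subseteq> {1..n} \<times> {1..n}" using P(1) NM Q(1) by auto
      show "rook (P \<union> Q)" using P(2) Q(2) disj by (rule rook_Un)
      show "fst ` (P \<union> Q) = {1..n}" "snd ` (P \<union> Q) = {1..n}"
        unfolding image_Un P N_def M_def using Qfst by auto
    qed (use c r in auto)
    then obtain w where w: "w \<in> colored_perms n r"
      and color: "\<And>l. color_class n w l = {p \<in> P \<union> Q. (if p \<in> Q then c p else 0) = l}" by blast
    have "c p \<noteq> 0" if "p \<in> Q" for p using c[OF that] by simp
    then have "color_class n w 0 = P" unfolding color using PQ by fastforce
    moreover have "color_class n w l = {p \<in> Q. c p = l}" if "l \<in> {1..r - 1}" for l
      unfolding color using that by auto
    ultimately have "shadow_monomial n r w =
        (\<Prod>l = 1..r - 1. set_monomial {p \<in> Q. c p = l} ^ l) * set_monomial R ^ r"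
      unfolding shadow_monomial_def using P(5) by simp
    also have "(\<Prod>l = 1..r - 1. set_monomial {p \<in> Q. c p = l} ^ l) =
        (\<Prod>l = 1..r - 1. \<Prod>p\<in>{p \<in> Q. c p = l}. var p ^ c p)"
      unfolding set_monomial_def prod_power_distrib by (intro prod.cong) auto
    also have "\<dots> = m" unfolding m_def
    proof (rule prod.group[OF finQ])
      show "c ` Q \<subseteq> {1..r - 1}"
      proof (rule image_subsetI)
        fix p assume "p \<in> Q"
        then show "c p \<in> {1..r - 1}" using c[of p] by auto
      qed
    qed simp
    finally have "shadow_monomial n r w = prod z R * m"
      by (simp add: set_monomial_def prod_power_distrib z_def mult.commute)
    then show ?thesis using gen[OF w] by simp
  qed
  then show ?case unfolding goal .
qed

text \<open>Polynomials are linear combinations of monomials. A monomial with an exponent above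
  \<open>r\<close> or with two attacking cells lies in the ideal; in any other, the cells with
  exponent \<open>r\<close> and those with smaller positive exponent are the \<open>R\<close> and
  \<open>Q\<close> of \<open>monomials_spanned\<close>.\<close>

lemma poly_ring_spanned:
  assumes W: "colored_ideal n r \<subseteq> W" "\<And>f g. f \<in> W \<Longrightarrow> g \<in> W \<Longrightarrow> f + g \<in> W"
      "\<And>k f. f \<in> W \<Longrightarrow> const_poly k * f \<in> W"
    and gen: "\<And>w. w \<in> colored_perms n r \<Longrightarrow> shadow_monomial n r w \<in> W"
    and r: "0 < r"
  shows "carrier (poly_ring n) \<subseteq> W"
proof
  fix f assume f: "f \<in> carrier (poly_ring n)"
  have uminus: "- g \<in> W" if "g \<in> W" for g
  proof -
    have "const_poly (- 1) * g = - g"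
      by (simp add: const_poly_def single_uminus)
    then show ?thesis using W(3)[OF that, of "- 1"] by simp
  qed
  have mono: "Poly_Mapping.single a 1 \<in> W" if a: "Poly_Mapping.keys a \<subseteq> {1..n} \<times> {1..n}" for a
  proof -
    define c where "c = Poly_Mapping.lookup a"
    have c: "0 < c p" if "p \<in> Poly_Mapping.keys a" for p
      using that unfolding c_def by (simp add: in_keys_iff)
    have C: "var p ^ c p \<in> carrier (poly_ring n)" if "p \<in> Poly_Mapping.keys a" for p
      using that a by (intro power_C var_in_poly_ring) auto
    have prod: "Poly_Mapping.single a 1 = (\<Prod>p\<in>Poly_Mapping.keys a. var p ^ c p)"
      unfolding c_def by (rule single_one_eq_prod)
    consider p where "p \<in> Poly_Mapping.keys a" "r < c p"
      | p q where "p \<in> Poly_Mapping.keys a" "q \<in> Poly_Mapping.keys a" "p \<noteq> q" "fst p = fst q \<or> snd p = snd q"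
      | "rook (Poly_Mapping.keys a)" "\<And>p. p \<in> Poly_Mapping.keys a \<Longrightarrow> c p \<le> r"
      unfolding rook_def inj_on_def by (meson not_le)
    then show ?thesis
    proof cases
      case 1
      then have "(\<Prod>p\<in>Poly_Mapping.keys a. var p ^ c p) * 1 \<in> colored_ideal n r"
        using a C by (intro prod_I[of _ p]) (auto intro!: var_high_power)
      then show ?thesis unfolding prod using W(1) by auto
    next
      case 2
      then have "(\<Prod>p\<in>Poly_Mapping.keys a. var p ^ c p) \<in> colored_ideal n r"
        using a C c by (intro prod_I2[of _ p q] attacking_powers) auto
      then show ?thesis unfolding prod using W(1) by auto
    next
      case 3
      define Q where "Q = {p \<in> Poly_Mapping.keys a. c p < r}"
      define R where "R = {p \<in> Poly_Mapping.keys a. c p = r}"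
      have QR: "Poly_Mapping.keys a = R \<union> Q" "R \<inter> Q = {}" unfolding Q_def R_def using 3(2) by fastforce+
      have fin: "finite Q" "finite R" unfolding Q_def R_def by auto
      have "Poly_Mapping.single a 1 = (\<Prod>p\<in>R. var p ^ c p) * (\<Prod>p\<in>Q. var p ^ c p)"
        unfolding prod QR(1) by (rule prod.union_disjoint[OF fin(2,1) QR(2)])
      also have "(\<Prod>p\<in>R. var p ^ c p) = (\<Prod>p\<in>R. var p ^ r)" by (intro prod.cong) (auto simp: R_def)
      also have "\<dots> * (\<Prod>p\<in>Q. var p ^ c p) \<in> W"
      proof (rule monomials_spanned[OF W(1,2) uminus gen _ _ _ r])
        show "Q \<subseteq> {1..n} \<times> {1..n}" using a unfolding Q_def by auto
        show "rook Q" "rook R" using 3(1) QR(1) by (auto intro: rook_subset)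
        show "R \<subseteq> ({1..n} - fst ` Q) \<times> ({1..n} - snd ` Q)"
        proof
          fix p assume p: "p \<in> R"
          have "fst p \<noteq> fst q \<and> snd p \<noteq> snd q" if "q \<in> Q" for q
            using 3(1) p that QR unfolding rook_def by (metis IntI UnCI emptyE inj_onD)
          moreover have "p \<in> {1..n} \<times> {1..n}" using a p unfolding R_def by auto
          ultimately show "p \<in> ({1..n} - fst ` Q) \<times> ({1..n} - snd ` Q)" by (auto simp: mem_Times_iff)
        qed
      qed (use c in \<open>auto simp: Q_def\<close>)
      finally show ?thesis .
    qed
  qed
  have sum_W: "sum g A \<in> W" if "\<And>x. x \<in> A \<Longrightarrow> g x \<in> W" for g :: "_ \<Rightarrow> cpoly" and A :: "((nat \<times> nat) \<Rightarrow>\<^sub>0 nat) set"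
    using that zero_I W by (induction A rule: infinite_finite_induct) auto
  have "(\<Sum>a\<in>Poly_Mapping.keys f. const_poly (Poly_Mapping.lookup f a) * Poly_Mapping.single a 1) \<in> W"
    using f mono unfolding poly_ring_carrier_iff by (intro sum_W W(3)) auto
  then show "f \<in> W" by (simp only: cpoly_expansion[of f, symmetric])
qed

end

section \<open>Passage to the quotient algebra\<close>

theorem theorem3p17:
  fixes n r :: nat
  assumes "n \<ge> 1" and "r \<ge> 1"
  shows "module.gen_set class_ring (quotient_algebra n r)
           (residue_class n r ` shadow_monomial n r ` colored_perms n r)"
proof -
  let ?R = "poly_ring n" and ?I = "colored_ideal n r"
  let ?Q = "?R Quot ?I" and ?V = "quotient_algebra n r"
  let ?S = "residue_class n r ` shadow_monomial n r ` colored_perms n r"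
  interpret I: ideal ?I ?R by (rule colored_ideal_ideal)
  interpret h: ring_hom_ring ?R ?Q "residue_class n r"
    using I.rcos_ring_hom_ring unfolding residue_class_def by (simp add: eta_contract_eq)
  interpret V: vectorspace class_ring ?V by (rule quotient_algebra_vectorspace)
  have V: "carrier ?V = carrier ?Q" "zero ?V = zero ?Q" "add ?V = add ?Q"
    "smult ?V = (\<lambda>c X. residue_class n r (const_poly c) \<otimes>\<^bsub>?Q\<^esub> X)"
    by (simp_all add: quotient_algebra_def Let_def)
  have carrier_Q: "carrier ?Q = residue_class n r ` carrier ?R"
    by (auto simp: FactRing_def A_RCOSETS_def' residue_class_def)
  have S: "?S \<subseteq> carrier ?V"
    unfolding V carrier_Q using shadow_monomial_in_poly_ring by blast
  interpret span: submodule class_ring "V.span ?S" ?V by (rule V.span_is_submodule[OF S])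
  \<comment> \<open>Pulling the span back along the residue map reduces the claim to
    \<open>poly_ring_spanned\<close>, because every element of the quotient is the class of a
    polynomial.\<close>
  define W where "W = {f \<in> carrier ?R. residue_class n r f \<in> V.span ?S}"
  have "carrier ?R \<subseteq> W"
  proof (rule poly_ring_spanned)
    show "?I \<subseteq> W"
    proof
      fix f assume f: "f \<in> ?I"
      then have "residue_class n r f = zero ?V"
        unfolding residue_class_def V FactRing_def using I.a_rcos_const by simp
      then show "f \<in> W" using f I.a_subset span.zero_closed unfolding W_def by auto
    qed
    show "f + g \<in> W" if "f \<in> W" "g \<in> W" for f g
    proof -
      have "residue_class n r (f + g) = residue_class n r f \<oplus>\<^bsub>?V\<^esub> residue_class n r g"
        using h.hom_add[of f g] that unfolding W_def V by simp
      then show ?thesis using that span.m_closed poly_ring_add unfolding W_def by auto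
    qed
    show "const_poly k * f \<in> W" if "f \<in> W" for k f
    proof -
      have "residue_class n r (const_poly k * f) = k \<odot>\<^bsub>?V\<^esub> residue_class n r f"
        using h.hom_mult[of "const_poly k" f] that const_poly_in_poly_ring unfolding W_def V by simp
      then show ?thesis
        using that span.smult_closed[of k] poly_ring_mult const_poly_in_poly_ring unfolding W_def by auto
    qed
    show "shadow_monomial n r w \<in> W" if "w \<in> colored_perms n r" for w
      using that V.in_own_span[OF S] shadow_monomial_in_poly_ring unfolding W_def by blast
    show "0 < r" using assms(2) by simp
  qed
  then have "carrier ?V \<subseteq> V.span ?S" unfolding V carrier_Q W_def by auto
  then show ?thesis using span.subset by (simp add: subset_antisym)
qed

end
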